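(* (i) For all integers $n,d$ such that $d\equiv 8\pmod{57}$, $d\ge 8$, $n\ge 2d$ and $n\equiv 0\pmod{57}$, we have $\gamma^{LD}(C_n(1,d-1,d))=\frac{13n}{57}$. (ii) There exist integers $n_k$, $d_k\ge 3$ with $d_k\le n_k/2$ and identifying codes $C_k$ in the circulant graphs $C_{n_k}(1,d_k-1,d_k)$ ($k=1,2,\dots$) such that $\lim_{k\to\infty}|C_k|/n_k=1/4$.
   Context: All graphs are simple and undirected. For a graph $G=(V,E)$ and $u\in V$, $N[u]=\{u\}\cup\{v: uv\in E\}$. A code is a nonempty $C\subseteq V$, and $I(C;u)=N[u]\cap C$. $C$ is dominating if $I(C;u)\neq\emptyset$ for all $u$; identifying if dominating and $I(C;u)\neq I(C;v)$ for all distinct $u,v\in V$; locating-dominating if dominating and $I(C;u)\neq I(C;v)$ for all distinct $u,v\in V\setminus C$. $\gamma^{LD}(G)$ denotes the minimum cardinality of a locating-dominating code in a finite graph $G$. For positive integers $n$ and $d_1,\dots,d_k\le n/2$, the circulant graph $C_n(d_1,\dots,d_k)$ has vertex set $\mathbb{Z}_n$, and the open neighbourhood of $u$ is $\{u\pm d_1,\dots,u\pm d_k\}$ modulo $n$. *)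

theory Defs
  imports "HOL-Analysis.Analysis" "HOL-Number_Theory.Cong" "Graph_Theory.Pair_Digraph"
begin

text \<open>
  Simple undirected graphs are pair digraphs whose arc relation is symmetric and irreflexive:
  an edge \<open>uv\<close> is represented by the two arcs \<open>(u, v)\<close> and \<open>(v, u)\<close>.
\<close>

definition closed_nbhd :: "'a pair_pre_digraph \<Rightarrow> 'a \<Rightarrow> 'a set" where
  "closed_nbhd G u = {u} \<union> {v. (u, v) \<in> parcs G}"

definition is_code :: "'a pair_pre_digraph \<Rightarrow> 'a set \<Rightarrow> bool" where
  "is_code G C \<longleftrightarrow> C \<subseteq> pverts G \<and> C \<noteq> {}"

definition I_set :: "'a pair_pre_digraph \<Rightarrow> 'a set \<Rightarrow> 'a \<Rightarrow> 'a set" where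
  "I_set G C u = closed_nbhd G u \<inter> C"

definition dominating :: "'a pair_pre_digraph \<Rightarrow> 'a set \<Rightarrow> bool" where
  "dominating G C \<longleftrightarrow> is_code G C \<and> (\<forall>u \<in> pverts G. I_set G C u \<noteq> {})"

definition identifying :: "'a pair_pre_digraph \<Rightarrow> 'a set \<Rightarrow> bool" where
  "identifying G C \<longleftrightarrow> dominating G C \<and>
     (\<forall>u \<in> pverts G. \<forall>v \<in> pverts G. u \<noteq> v \<longrightarrow> I_set G C u \<noteq> I_set G C v)"

definition locating_dominating :: "'a pair_pre_digraph \<Rightarrow> 'a set \<Rightarrow> bool" where
  "locating_dominating G C \<longleftrightarrow> dominating G C \<and>
     (\<forall>u \<in> pverts G - C. \<forall>v \<in> pverts G - C. u \<noteq> v \<longrightarrow> I_set G C u \<noteq> I_set G C v)"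

definition gamma_LD :: "'a pair_pre_digraph \<Rightarrow> nat" where
  "gamma_LD G = Min (card ` {C. locating_dominating G C})"

text \<open>
  The ring of integers modulo \<open>n\<close> is represented by its residues \<open>{0..<n}\<close>. The definition is
  meant for distances \<open>d\<close> with \<open>1 \<le> d\<close> and \<open>2 * d \<le> n\<close>; outside this range there may be loops.
\<close>

definition circulant :: "int \<Rightarrow> int set \<Rightarrow> int pair_pre_digraph" where
  "circulant n D = \<lparr> pverts = {0..<n},
     parcs = {(u, v). u \<in> {0..<n} \<and> (\<exists>d \<in> D. v = (u + d) mod n \<or> v = (u - d) mod n)} \<rparr>"

lemma pair_graph_circulant:
  assumes "n > 0" and D: "\<And>d. d \<in> D \<Longrightarrow> 1 \<le> d \<and> 2 * d \<le> n"
  shows "pair_graph (circulant n D)"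
proof -
  have sub: "parcs (circulant n D) \<subseteq> {0..<n} \<times> {0..<n}"
    using \<open>n > 0\<close> by (auto simp: circulant_def)
  have noloop: "u \<noteq> (u + d) mod n" "u \<noteq> (u - d) mod n" if "u \<in> {0..<n}" "d \<in> D" for u d
  proof -
    have "\<not> n dvd d" using D[OF that(2)] by (auto dest: zdvd_imp_le)
    moreover have "u mod n = u" using that(1) by simp
    ultimately show "u \<noteq> (u + d) mod n" "u \<noteq> (u - d) mod n"
      using mod_eq_dvd_iff[of "u + d" n u] mod_eq_dvd_iff[of u n "u - d"] by auto
  qed
  have sym: "(v, u) \<in> parcs (circulant n D)" if uv: "(u, v) \<in> parcs (circulant n D)" for u v
  proof -
    obtain d where d: "u \<in> {0..<n}" "d \<in> D" "v = (u + d) mod n \<or> v = (u - d) mod n"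
      using uv unfolding circulant_def by auto
    then have "u = (v - d) mod n \<or> u = (v + d) mod n"
      by (auto simp: mod_simps)
    moreover have "v \<in> {0..<n}" using sub uv by blast
    ultimately show ?thesis
      using d(2) unfolding circulant_def by auto
  qed
  show ?thesis
  proof unfold_locales
    show "finite (parcs (circulant n D))"
      using sub finite_subset by blast
    show "symmetric (with_proj (circulant n D))"
      using sym by (auto simp: symmetric_def sym_def)
  qed (use sub noloop in \<open>auto simp: circulant_def\<close>)
qed

lemma locating_dominating_verts:
  "pverts G \<noteq> {} \<Longrightarrow> locating_dominating G (pverts G)"
  by (auto simp: locating_dominating_def dominating_def is_code_def I_set_def closed_nbhd_def)

lemma gamma_LD_attained:
  assumes "finite (pverts G)" "pverts G \<noteq> {}"
  shows "\<exists>C. locating_dominating G C \<and> card C = gamma_LD G"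
    and "locating_dominating G C \<Longrightarrow> gamma_LD G \<le> card C"
proof -
  have "finite {C. locating_dominating G C}"
    by (rule finite_subset[of _ "Pow (pverts G)"])
      (use assms in \<open>auto simp: locating_dominating_def dominating_def is_code_def\<close>)
  then have fin: "finite (card ` {C. locating_dominating G C})" by simp
  have "card ` {C. locating_dominating G C} \<noteq> {}"
    using locating_dominating_verts[OF assms(2)] by auto
  from Min_in[OF fin this] show "\<exists>C. locating_dominating G C \<and> card C = gamma_LD G"
    by (auto simp: gamma_LD_def)
  show "locating_dominating G C \<Longrightarrow> gamma_LD G \<le> card C"
    using Min_le[OF fin] by (auto simp: gamma_LD_def)
qed

end

theory Submission
  imports Defs
begin

text \<open>
  Lower bound in (i): along \<open>(x, y) \<mapsto> x + d * y\<close> the code lifts to a doubly periodic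
  subset of the triangular grid. By domination and separation, a codeword has at most one neighbour
  that sees no other codeword, and every other non-codeword sees at least two. Counting the pairs of
  a vertex and a codeword in its closed neighbourhood for a code of size \<open>K\<close> therefore gives
  \<open>9 K = 2 n + E\<close>, where the excess \<open>E \<ge> 0\<close> collects adjacent codewords,
      codewords
  without a private neighbour, and non-codewords that see three or more codewords. The bound
  \<open>57 K \<ge> 13 n\<close> says \<open>13 E \<ge> 3 K\<close>; if a unit of excess is worth 78, every
  codeword needs 18 on average. The excess is first split among the codewords nearby (their
  charge). A codeword without charge has a completely determined surrounding, with exactly one
  hole among the six vertices at distance two straight ahead. Discharging rules depending on the
  types of the codewords around it give it 18 from codewords within distance five, and every donor
  keeps 18.

  Upper bound in (i): 13 residues modulo 57 form a locating-dominating code of the circulant graph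
  with distances 1, 7, 8, which lifts to all the graphs in question.

  For (ii): the points of the triangular grid with two even coordinates form an identifying code of
  density 1/4. In the circulant graph with \<open>n = 6 d\<close> and \<open>d\<close> even this code
  breaks only where a row of length \<open>d\<close> ends; making the six columns along that seam
  codewords repairs it at the cost of a bounded number of codewords.
\<close>

section \<open>Configurations on the triangular grid\<close>

text \<open>The amounts are read off the extremal code. Of its 13 residues six are poor with charge
  26, one is rich with charge 78, and the other six are uncharged with the rich one behind them. For
  all to end with 18, the rich one must give 10 to each of its six clients and each poor one 4 to
  each of two, and 10 + 4 + 4 = 18. The remaining rules replace these payments where such donors are
  missing. The ratio 78 : 18 is 13 : 3 scaled by six, so that thirds of a unit of excess and halves
  of a payment of 10 are integers.

  The lift is a covering, not an embedding: distant grid points may represent the same vertex.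
  Separation is therefore asked only for displacements of length at most two, which do not vanish
  modulo \<open>n\<close>. From there on the local part knows nothing of the graph. It treats
  arbitrary configurations on the infinite grid, where each claim is propositional logic about
  finitely many cells, and rotations reduce six directions to one. The graph returns only in the
  summation, where payments balance because totals do not change under shifts.\<close>

text \<open>
  The neighbours of the origin are \<open>(1, 0), (0, 1), (-1, 1), (-1, 0), (0, -1), (1, -1)\<close>,
  and \<open>rot\<close> turns the grid by 60 degrees.
\<close>

type_synonym config = "int \<times> int \<Rightarrow> bool"

fun shift :: "int \<Rightarrow> int \<Rightarrow> config \<Rightarrow> config" where
  "shift a b g (x, y) = g (x + a, y + b)"

text \<open>\<open>rot g\<close> shows in direction \<open>(1, 0)\<close> what \<open>g\<close> has
  in direction \<open>(0, 1)\<close>. So a predicate written for direction \<open>(1, 0)\<close>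
  speaks of the k-th direction when applied to the k-th rotation.\<close>

fun rot :: "config \<Rightarrow> config" where
  "rot g (x, y) = g (- y, x + y)"

abbreviation rot2 where "rot2 g \<equiv> rot (rot g)"
abbreviation rot3 where "rot3 g \<equiv> rot (rot2 g)"
abbreviation rot4 where "rot4 g \<equiv> rot (rot3 g)"
abbreviation rot5 where "rot5 g \<equiv> rot (rot4 g)"
abbreviation orbit where "orbit g \<equiv> {g, rot g, rot2 g, rot3 g, rot4 g, rot5 g}"

definition cyc :: "(config \<Rightarrow> int) \<Rightarrow> config \<Rightarrow> int" where
  "cyc F g = F g + F (rot g) + F (rot2 g) + F (rot3 g)
     + F (rot4 g) + F (rot5 g)"

definition some_rot :: "(config \<Rightarrow> bool) \<Rightarrow> config \<Rightarrow> bool" where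
  "some_rot Q g \<longleftrightarrow> Q g \<or> Q (rot g) \<or> Q (rot2 g) \<or> Q (rot3 g)
     \<or> Q (rot4 g) \<or> Q (rot5 g)"

lemma rot_6: "rot (rot5 g) = g"
  by (simp add: fun_eq_iff)

lemma cyc_rot: "cyc F (rot g) = cyc F g"
  by (simp add: cyc_def rot_6)

lemma some_rot_rot: "some_rot Q (rot g) = some_rot Q g"
  by (auto simp add: some_rot_def rot_6)

lemma shift_rot: "shift a b (rot g) = rot (shift (- b) (a + b) g)"
  by (simp add: fun_eq_iff algebra_simps)

lemma shift_shift: "shift a b (shift c d g) = shift (a + c) (b + d) g"
  by (simp add: fun_eq_iff algebra_simps)

lemma shift_0 [simp]: "shift 0 0 g = g"
  by (simp add: fun_eq_iff)

text \<open>
  Domination of the origin and its separation from the vertices \<open>(1, 0)\<close>,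
  \<open>(1, 1)\<close> and \<open>(2, 0)\<close>, which up to rotation are all the vertices at distance at
  most two; vertices further apart are separated by domination.
\<close>

definition locating_at :: "config \<Rightarrow> bool" where
  "locating_at g \<longleftrightarrow>
    (g (0, 0) \<or> g (1, 0) \<or> g (0, 1) \<or> g (-1, 1) \<or> g (-1, 0) \<or> g (0, -1)
        \<or> g (1, -1)) \<and>
    (\<not> g (0, 0) \<and> \<not> g (1, 0) \<longrightarrow>
      g (-1, 0) \<or> g (-1, 1) \<or> g (0, -1) \<or> g (2, 0) \<or> g (1, 1) \<or> g (2, -1)) \<and>
    (\<not> g (0, 0) \<and> \<not> g (1, 1) \<longrightarrow>
      g (-1, 1) \<or> g (-1, 0) \<or> g (0, -1) \<or> g (1, -1) \<or> g (2, 1) \<or> g (1, 2)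
          \<or> g (0, 2) \<or> g (2, 0)) \<and>
    (\<not> g (0, 0) \<and> \<not> g (2, 0) \<longrightarrow>
      g (0, 1) \<or> g (-1, 1) \<or> g (-1, 0) \<or> g (0, -1) \<or> g (1, -1) \<or>
      g (3, 0) \<or> g (2, 1) \<or> g (1, 1) \<or> g (2, -1) \<or> g (3, -1))"

text \<open>Three rotations are enough because separation is symmetric: a displacement and its
  negative are exchanged by moving the base point. This is the content of
  \<open>locating_at_rot3\<close>.\<close>

definition locating :: "config \<Rightarrow> bool" where
  "locating g \<longleftrightarrow> (\<forall>a b. locating_at (shift a b g)
      \<and> locating_at (rot (shift a b g)) \<and> locating_at (rot2 (shift a b g)))"

lemma locating_at_rot3: "locating g \<Longrightarrow> locating_at (rot3 (shift a b g))"
proof -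
  assume "locating g"
  then have "locating_at (shift a b g)" "locating_at (shift (a - 1) b g)"
      "locating_at (shift (a - 1) (b - 1) g)" "locating_at (shift (a - 2) b g)"
    by (auto simp: locating_def)
  then show ?thesis
    unfolding locating_at_def by (simp add: algebra_simps; argo)
qed

lemma locating_shift: "locating g \<Longrightarrow> locating (shift a b g)"
  by (simp add: locating_def shift_shift)

lemma locating_rot: "locating g \<Longrightarrow> locating (rot g)"
  using locating_at_rot3 by (simp add: locating_def shift_rot)

section \<open>Charges and the shape of codewords without charge\<close>

definition isolated :: "config \<Rightarrow> bool" where
  "isolated g \<longleftrightarrow> \<not> g (1, 0) \<and> \<not> g (0, 1) \<and> \<not> g (-1, 1)
      \<and> \<not> g (-1, 0) \<and> \<not> g (0, -1) \<and> \<not> g (1, -1)"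

text \<open>
  The next three predicates describe how the neighbour \<open>(1, 0)\<close> of an isolated codeword at
  the origin is covered: by the origin alone, by three codewords at mutual distance two (who share
  its unit of excess), or with an excess that goes to the origin alone.
\<close>

definition private_at :: "config \<Rightarrow> bool" where
  "private_at g \<longleftrightarrow> \<not> g (2, 0) \<and> \<not> g (1, 1) \<and> \<not> g (2, -1)"

definition trine :: "config \<Rightarrow> bool" where
  "trine g \<longleftrightarrow> \<not> g (2, 0) \<and> g (1, 1) \<and> g (2, -1)"

definition irregular :: "config \<Rightarrow> bool" where
  "irregular g \<longleftrightarrow> g (2, 0) \<and> (g (1, 1) \<or> g (2, -1))"

definition code_degree :: "config \<Rightarrow> int" where
  "code_degree g = of_bool (g (1, 0)) + of_bool (g (0, 1)) + of_bool (g (-1, 1)) + of_bool (g (-1, 0))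
        + of_bool (g (0, -1)) + of_bool (g (1, -1))"

text \<open>A codeword with code neighbours takes a unit for each of them and forgoes any share in
  the excess of non-codewords. Hence the charges may add up to less than the total excess.\<close>

definition charge :: "config \<Rightarrow> int" where
  "charge g = (if \<not> g (0, 0) then 0
    else if isolated g then 78 * of_bool (\<not> some_rot private_at g) + cyc (\<lambda>g. 26 * of_bool
        (trine g) + 78 * of_bool (irregular g)) g
    else 78 * code_degree g)"

lemma isolated_rot: "isolated (rot g) = isolated g" and code_degree_rot: "code_degree (rot g) = code_degree g"
  by (auto simp: isolated_def code_degree_def)

lemma charge_rot [simp]: "charge (rot g) = charge g"
  by (simp add: charge_def isolated_rot code_degree_rot some_rot_rot cyc_rot)

text \<open>The origin is a codeword without charge whose hole is \<open>(2, 0)\<close>.\<close>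

definition uncharged_at :: "config \<Rightarrow> bool" where
  "uncharged_at g \<longleftrightarrow> g (0, 0) \<and> isolated g \<and> \<not> g (2, 0)
      \<and> g (0, 2) \<and> g (-2, 2) \<and> g (-2, 0) \<and> g (0, -2) \<and> g (2, -2) \<and>
     \<not> g (1, 1) \<and> \<not> g (-1, 2) \<and> \<not> g (-2, 1) \<and> \<not> g (-1, -1)
         \<and> \<not> g (1, -2) \<and> \<not> g (2, -1)"

lemma charge_nonneg: "0 \<le> charge g"
  by (simp add: charge_def code_degree_def cyc_def)

lemma charge_pos_code: "0 < charge g \<Longrightarrow> g (0, 0)"
  by (auto simp: charge_def split: if_splits)

lemma uncharged_at_charge: "uncharged_at g \<Longrightarrow> charge g = 0"
  by (simp add: uncharged_at_def charge_def isolated_def cyc_def some_rot_def private_at_def trine_def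
      irregular_def)

lemma cyc_nonneg: "(\<And>g. 0 \<le> F g) \<Longrightarrow> 0 \<le> cyc F g"
  by (simp add: cyc_def)

lemma cyc_ge:
  assumes "\<And>g. 0 \<le> F g" "some_rot (\<lambda>g. c \<le> F g) g"
  shows "c \<le> cyc F g"
  using assms(2) assms(1)[of g] assms(1)[of "rot g"] assms(1)[of "rot2 g"] assms(1)[of "rot3 g"]
    assms(1)[of "rot4 g"] assms(1)[of "rot5 g"]
  unfolding some_rot_def cyc_def by linarith

lemma cyc_le: "(\<And>g. F g \<le> G g) \<Longrightarrow> cyc F g \<le> cyc G g"
  unfolding cyc_def by (intro add_mono) auto

lemma some_rot_mono: "some_rot Q g \<Longrightarrow> (\<And>g. Q g \<Longrightarrow> R g)
    \<Longrightarrow> some_rot R g"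
  by (auto simp: some_rot_def)

lemma charge_isolated:
  "g (0, 0) \<Longrightarrow> isolated g \<Longrightarrow>
    charge g = 78 * of_bool (\<not> some_rot private_at g) + cyc (\<lambda>g. 26 * of_bool (trine g) +
        78 * of_bool (irregular g)) g"
  by (simp add: charge_def)

lemma charge_lt_78:
  assumes "g (0, 0)" "charge g < 78"
  shows "isolated g" "some_rot private_at g" "\<not> some_rot irregular g"
proof -
  show isolated: "isolated g"
  proof (rule ccontr)
    assume n: "\<not> isolated g"
    then have "code_degree g \<ge> 1" by (auto simp: isolated_def code_degree_def)
    with n assms show False by (simp add: charge_def)
  qed
  have *: "0 \<le> cyc (\<lambda>g. 26 * of_bool (trine g) + 78 * of_bool (irregular g)) g"
    by (rule cyc_nonneg) auto
  then show "some_rot private_at g"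
    using assms isolated by (cases "some_rot private_at g") (auto simp: charge_isolated)
  show "\<not> some_rot irregular g"
  proof
    assume "some_rot irregular g"
    then have "78 \<le> cyc (\<lambda>g. 26 * of_bool (trine g) + 78 * of_bool (irregular g)) g"
      by (intro cyc_ge) (auto elim!: some_rot_mono)
    with assms isolated show False by (cases "some_rot private_at g") (auto simp: charge_isolated)
  qed
qed

lemma charge_0_no_trine:
  assumes "g (0, 0)" "charge g = 0"
  shows "\<not> some_rot trine g"
proof
  assume "some_rot trine g"
  then have "26 \<le> cyc (\<lambda>g. 26 * of_bool (trine g) + 78 * of_bool (irregular g)) g"
    by (intro cyc_ge) (auto elim!: some_rot_mono)
  moreover have "isolated g" using charge_lt_78 assms by simp
  ultimately show False using assms by (cases "some_rot private_at g") (auto simp: charge_isolated)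
qed

lemma charge_pos_trine:
  assumes "0 < charge g" "charge g < 78"
  shows "some_rot trine g"
proof (rule ccontr)
  assume n: "\<not> some_rot trine g"
  have g: "g (0, 0)" using assms by (simp add: charge_pos_code)
  note c = charge_lt_78[OF g assms(2)]
  have "charge g = 0"
    using n c g by (simp add: charge_isolated cyc_def some_rot_def)
  with assms show False by simp
qed

lemma charge_pos_26: "0 < charge g \<Longrightarrow> 26 \<le> charge g"
proof (cases "charge g < 78")
  case True
  assume "0 < charge g"
  then have g: "g (0, 0)" and t: "some_rot trine g" using charge_pos_trine True
    by (auto simp: charge_pos_code)
  then have "26 \<le> cyc (\<lambda>g. 26 * of_bool (trine g) + 78 * of_bool (irregular g)) g"
    by (intro cyc_ge) (auto elim!: some_rot_mono)
  with g charge_lt_78[OF g True] show ?thesis by (auto simp: charge_isolated)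
qed simp

text \<open>Two private neighbours could not be separated, so each of the other five neighbours is
  covered a second time. A cover from a diagonal cell such as \<open>(-1, 2)\<close> would also
  cover the next neighbour, and separating these two would need a third codeword, hence a trine or
  an irregular neighbour. So all five are covered from straight ahead.\<close>

lemma private_at_uncharged_at:
  assumes "locating g" "g (0, 0)" "isolated g" "private_at g" "\<not> some_rot trine g"
      "\<not> some_rot irregular g"
  shows "uncharged_at g"
proof -
  note locating = assms(1)[unfolded locating_def, rule_format]
  show ?thesis
    using locating[of "-1" 1] locating[of "-1" 0]  locating[of "0" "-1"]  locating[of 1 "-1"]
        locating[of 0 1]  locating[of 1 0] assms(2-)
    unfolding uncharged_at_def isolated_def private_at_def some_rot_def trine_def irregular_def
        locating_at_def by (simp; argo)
qed

lemma charge_0_iff: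
  assumes "locating g" "g (0, 0)"
  shows "charge g = 0 \<longleftrightarrow> some_rot uncharged_at g"
proof
  assume c: "charge g = 0"
  then have "isolated g" "some_rot private_at g" "\<not> some_rot irregular g" "\<not> some_rot trine g"
    using assms charge_lt_78 charge_0_no_trine by auto
  have *: "private_at f \<longrightarrow> uncharged_at f" if "locating f" "f (0, 0)" "charge f = 0" for f
    using that private_at_uncharged_at[of f] charge_lt_78[of f] charge_0_no_trine[of f] by auto
  have "f (0, 0) \<Longrightarrow> rot f (0, 0)" for f by simp
  then have "private_at (f) \<longrightarrow> uncharged_at (f)" if "f \<in> orbit g" for f
    using that assms c by (intro *) (auto simp: locating_rot)
  then show "some_rot uncharged_at g"
    using \<open>some_rot private_at g\<close> unfolding some_rot_def by (simp; blast)
next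
  assume "some_rot uncharged_at g"
  then show "charge g = 0" unfolding some_rot_def by (auto dest: uncharged_at_charge)
qed

text \<open>
  A codeword of positive charge is called poor if its charge is below 78, and rich otherwise.
\<close>

lemma poor_codeword:
  assumes "0 < charge g" "charge g < 78"
  shows "g (0, 0) \<and> isolated g \<and> some_rot private_at g \<and> \<not> some_rot irregular g
      \<and> some_rot trine g"
  using assms charge_lt_78[of g] charge_pos_trine[of g] charge_pos_code[of g] by auto

text \<open>Each of these codewords has three consecutive neighbours that are covered from straight
  ahead by codewords around the origin, so they are neither private nor trines. Of the other three,
  a trine at an outer one would make a covered one irregular, and a trine at the middle one would
  leave no private neighbour.\<close>

lemma rear_not_poor:
  assumes "uncharged_at g"
  shows "charge (shift (-2) 0 g) \<le> 0 \<or> 78 \<le> charge (shift (-2) 0 g)"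
    and "charge (shift (-2) 2 g) \<le> 0 \<or> 78 \<le> charge (shift (-2) 2 g)"
    and "charge (shift 0 (-2) g) \<le> 0 \<or> 78 \<le> charge (shift 0 (-2) g)"
proof -
  have "\<not> (g (-2, 0) \<and> isolated (shift (-2) 0 g) \<and> some_rot private_at (shift (-2) 0 g)
      \<and> \<not> some_rot irregular (shift (-2) 0 g) \<and> some_rot trine (shift (-2) 0 g))"
    using assms unfolding uncharged_at_def isolated_def some_rot_def private_at_def irregular_def
        trine_def by (simp; argo)
  then have "\<not> (0 < charge (shift (-2) 0 g) \<and> charge (shift (-2) 0 g) < 78)"
    using poor_codeword[of "shift (-2) 0 g"] by auto
  then show "charge (shift (-2) 0 g) \<le> 0 \<or> 78 \<le> charge (shift (-2) 0 g)" by linarith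
  have "\<not> (g (-2, 2) \<and> isolated (shift (-2) 2 g) \<and> some_rot private_at (shift (-2) 2 g)
      \<and> \<not> some_rot irregular (shift (-2) 2 g) \<and> some_rot trine (shift (-2) 2 g))"
    using assms unfolding uncharged_at_def isolated_def some_rot_def private_at_def irregular_def
        trine_def by (simp; argo)
  then have "\<not> (0 < charge (shift (-2) 2 g) \<and> charge (shift (-2) 2 g) < 78)"
    using poor_codeword[of "shift (-2) 2 g"] by auto
  then show "charge (shift (-2) 2 g) \<le> 0 \<or> 78 \<le> charge (shift (-2) 2 g)" by linarith
  have "\<not> (g (0, -2) \<and> isolated (shift 0 (-2) g) \<and> some_rot private_at (shift 0 (-2) g)
      \<and> \<not> some_rot irregular (shift 0 (-2) g) \<and> some_rot trine (shift 0 (-2) g))"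
    using assms unfolding uncharged_at_def isolated_def some_rot_def private_at_def irregular_def
        trine_def by (simp; argo)
  then have "\<not> (0 < charge (shift 0 (-2) g) \<and> charge (shift 0 (-2) g) < 78)"
    using poor_codeword[of "shift 0 (-2) g"] by auto
  then show "charge (shift 0 (-2) g) \<le> 0 \<or> 78 \<le> charge (shift 0 (-2) g)" by linarith
qed

section \<open>Servers in front of a shared hole\<close>

lemma three_trines:
  assumes "g (0, 0)" "isolated g" "trine g" "trine (rot g)" "trine (rot2 g)"
  shows "78 \<le> charge g"
  using assms by (simp add: charge_isolated cyc_def)

text \<open>The hole \<open>(2, 0)\<close> lies straight ahead of the side as well, and an uncharged
  codeword has only one non-codeword straight ahead.\<close>

lemma side_left_hole:
  assumes "locating g" "uncharged_at g" "charge (shift 0 2 g) = 0"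
  shows "uncharged_at (rot5 (shift 0 2 g))"
proof -
  have "some_rot uncharged_at (shift 0 2 g)"
    using assms charge_0_iff[of "shift 0 2 g"] by (auto simp: locating_shift uncharged_at_def)
  then show ?thesis
    using assms(2) unfolding some_rot_def uncharged_at_def isolated_def by (simp; argo)
qed

lemma side_right_hole:
  assumes "locating g" "uncharged_at g" "charge (shift 2 (-2) g) = 0"
  shows "uncharged_at (rot (shift 2 (-2) g))"
proof -
  have "some_rot uncharged_at (shift 2 (-2) g)"
    using assms charge_0_iff[of "shift 2 (-2) g"] by (auto simp: locating_shift uncharged_at_def)
  then show ?thesis
    using assms(2) unfolding some_rot_def uncharged_at_def isolated_def by (simp; argo)
qed

lemma locating_D:
  assumes "locating g"
  shows "locating_at (shift a b g)" "locating_at (rot (shift a b g))" "locating_at (rot2 (shift a b g))"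
  using assms by (auto simp: locating_def)

text \<open>Everything else around the hole is empty, so domination forces the codeword
  \<open>(3, 0)\<close>. If it is isolated, \<open>(2, 1)\<close> sees only \<open>(3, 0)\<close>
  and \<open>(2, 2)\<close>, which \<open>(3, 1)\<close> sees too. Separating them without an
  irregular neighbour makes \<open>(3, 1)\<close> a trine. By symmetry so is \<open>(4, -1)\<close>,
  and then \<open>(4, 0)\<close> between them, and three thirds make a full unit.\<close>

lemma server_mid:
  assumes "locating g" "uncharged_at g" "charge (shift 0 2 g) = 0" "charge (shift 2 (-2) g) = 0"
  shows "78 \<le> charge (shift 3 0 g)"
proof (rule ccontr)
  assume n: "\<not> ?thesis"
  define f where "f = shift 3 0 g"
  note P = assms(2) side_left_hole[OF assms(1-3)] side_right_hole[OF assms(1,2,4)]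
  have f0: "f (0, 0)"
    using P locating_D(1)[OF assms(1), of 2 0]
    unfolding f_def uncharged_at_def isolated_def locating_at_def by (simp; argo)
  have f: "isolated f" "\<not> some_rot irregular f" using n f0 charge_lt_78[of f] by (auto simp: f_def)
  have "trine (rot5 f) \<and> trine f \<and> trine (rot f)"
    using P f0 f locating_D[OF assms(1), of 2 1] locating_D[OF assms(1), of 3 "-1"]
        locating_D[OF assms(1), of 4 "-1"]
    unfolding f_def uncharged_at_def isolated_def locating_at_def some_rot_def irregular_def trine_def
        by (simp; argo)
  then have "78 \<le> charge (rot5 f)"
    using f0 f by (intro three_trines) (auto simp: isolated_rot rot_6)
  with n show False by (simp add: f_def)
qed

text \<open>Domination of the hole leaves \<open>(3, 0)\<close> in front of the origin and
  \<open>(3, -1)\<close> in front of its partner \<open>(0, 2)\<close>. Either would be rich by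
  three trines as in \<open>server_mid\<close>, unless a further codeword, the aide, interferes. The
  aide \<open>(3, -2)\<close> is adjacent to \<open>(2, -2)\<close> and the aide
  \<open>(3, 1)\<close> to \<open>(2, 2)\<close>, codewords straight ahead of the pair, so an aide
  is always rich.\<close>

lemma server_pair_left:
  assumes "locating g" "uncharged_at g" "charge (shift 0 2 g) = 0" "charge (shift 3 0 g) < 78"
      "charge (shift 3 (-1) g) < 78"
  shows "g (3, 0) \<and> g (3, -2) \<or> g (3, -1) \<and> g (3, 1)"
proof -
  note P = assms(2) side_left_hole[OF assms(1-3)]
  have "g (3, 0) \<or> g (3, -1)"
    using P locating_D(1)[OF assms(1), of 2 0]
    unfolding uncharged_at_def isolated_def locating_at_def by (simp; argo)
  moreover have "g (3, -2)" if q: "g (3, 0)"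
  proof (rule ccontr)
    assume n: "\<not> g (3, -2)"
    define f where "f = shift 3 0 g"
    have f: "f (0, 0)" "isolated f" "\<not> some_rot irregular f" using q assms(4) charge_lt_78[of f]
      by (auto simp: f_def)
    have "trine (rot5 f) \<and> trine f \<and> trine (rot f)"
      using P f n locating_D[OF assms(1), of 2 0] locating_D[OF assms(1), of 2 1]
          locating_D[OF assms(1), of 3 "-1"] locating_D[OF assms(1), of 4 "-1"]
      unfolding f_def uncharged_at_def isolated_def locating_at_def some_rot_def irregular_def trine_def
          by (simp; argo)
    then have "78 \<le> charge (rot5 f)"
      using f by (intro three_trines) (auto simp: isolated_rot rot_6)
    with assms(4) show False by (simp add: f_def)
  qed
  moreover have "g (3, 1)" if q: "g (3, -1)"
  proof (rule ccontr)
    assume n: "\<not> g (3, 1)"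
    define f where "f = shift 3 (-1) g"
    have f: "f (0, 0)" "isolated f" "\<not> some_rot irregular f" using q assms(5) charge_lt_78[of f]
      by (auto simp: f_def)
    have "trine (rot4 f) \<and> trine (rot5 f) \<and> trine f"
      using P f n locating_D[OF assms(1), of 2 0] locating_D[OF assms(1), of 3 0]
          locating_D[OF assms(1), of 2 "-1"] locating_D[OF assms(1), of 3 "-2"]
          locating_D[OF assms(1), of 4 "-1"] locating_D[OF assms(1), of 4 "-2"]
      unfolding f_def uncharged_at_def isolated_def locating_at_def some_rot_def irregular_def trine_def
          by (simp; argo)
    then have "78 \<le> charge (rot4 f)"
      using f by (intro three_trines) (auto simp: isolated_rot rot_6)
    with assms(5) show False by (simp add: f_def)
  qed
  ultimately show ?thesis by blast
qed

text \<open>The mirror image of \<open>server_pair_left\<close>. Only rotations act on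
  configurations here, so reflected statements are proved separately.\<close>

lemma server_pair_right:
  assumes "locating g" "uncharged_at g" "charge (shift 2 (-2) g) = 0" "charge (shift 3 0 g) < 78"
      "charge (shift 2 1 g) < 78"
  shows "g (3, 0) \<and> g (1, 2) \<or> g (2, 1) \<and> g (4, -1)"
proof -
  note P = assms(2) side_right_hole[OF assms(1-3)]
  have "g (3, 0) \<or> g (2, 1)"
    using P locating_D(1)[OF assms(1), of 2 0]
    unfolding uncharged_at_def isolated_def locating_at_def by (simp; argo)
  moreover have "g (1, 2)" if q: "g (3, 0)"
  proof (rule ccontr)
    assume n: "\<not> g (1, 2)"
    define f where "f = shift 3 0 g"
    have f: "f (0, 0)" "isolated f" "\<not> some_rot irregular f" using q assms(4) charge_lt_78[of f]
      by (auto simp: f_def)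
    have "trine (rot5 f) \<and> trine f \<and> trine (rot f)"
      using P f n locating_D[OF assms(1), of 2 0] locating_D[OF assms(1), of 2 1]
          locating_D[OF assms(1), of 3 "-1"] locating_D[OF assms(1), of 4 "-1"]
          locating_D[OF assms(1), of 3 1]
      unfolding f_def uncharged_at_def isolated_def locating_at_def some_rot_def irregular_def trine_def
          by (simp; argo)
    then have "78 \<le> charge (rot5 f)"
      using f by (intro three_trines) (auto simp: isolated_rot rot_6)
    with assms(4) show False by (simp add: f_def)
  qed
  moreover have "g (4, -1)" if q: "g (2, 1)"
  proof (rule ccontr)
    assume n: "\<not> g (4, -1)"
    define f where "f = shift 2 1 g"
    have f: "f (0, 0)" "isolated f" "\<not> some_rot irregular f" using q assms(5) charge_lt_78[of f]
      by (auto simp: f_def)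
    have "trine f \<and> trine (rot f) \<and> trine (rot2 f)"
      using P f n locating_D[OF assms(1), of 2 0] locating_D[OF assms(1), of 3 0]
          locating_D[OF assms(1), of 1 1] locating_D[OF assms(1), of 1 2]
          locating_D[OF assms(1), of 3 1] locating_D[OF assms(1), of 2 2]
      unfolding f_def uncharged_at_def isolated_def locating_at_def some_rot_def irregular_def trine_def
          by (simp; argo)
    then have "78 \<le> charge f"
      using f by (intro three_trines) (auto simp: isolated_rot rot_6)
    with assms(5) show False by (simp add: f_def)
  qed
  ultimately show ?thesis by blast
qed

section \<open>The discharging rules\<close>

text \<open>
  The rules are stated for a recipient at the origin with its hole at \<open>(2, 0)\<close>. Its sides
  are \<open>(0, 2)\<close> and \<open>(2, -2)\<close>; an uncharged side has the same hole. Each charged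
  side pays 4, and a rich one pays 14 if the other side is charged too.
\<close>

definition side_left :: "config \<Rightarrow> int" where
  "side_left g = (if uncharged_at g \<and> 0 < charge (shift 0 2 g) then
     (if 78 \<le> charge (shift 0 2 g) \<and> 0 < charge (shift 2 (-2) g) then 14 else 4) else 0)"

definition side_right :: "config \<Rightarrow> int" where
  "side_right g = (if uncharged_at g \<and> 0 < charge (shift 2 (-2) g) then
     (if 78 \<le> charge (shift 2 (-2) g) \<and> 0 < charge (shift 0 2 g) then 14 else 4) else 0)"

text \<open>
  If both sides are poor, the missing 10 come from the rich codewords among the three behind, or,
  if there are none, from those behind the one at \<open>(-2, 0)\<close>, whose hole is then opposite.
\<close>

definition needs_rear :: "config \<Rightarrow> bool" where
  "needs_rear g \<longleftrightarrow> uncharged_at g \<and> 0 < charge (shift 0 2 g)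
      \<and> charge (shift 0 2 g) < 78 \<and> 0 < charge (shift 2 (-2) g) \<and> charge (shift 2 (-2) g) < 78"

definition rear :: "int \<Rightarrow> int \<Rightarrow> config \<Rightarrow> int" where
  "rear a b g = (if needs_rear g \<and> 78 \<le> charge (shift a b g) then 10 else 0)"

definition back_to_back :: "config \<Rightarrow> bool" where
  "back_to_back g \<longleftrightarrow> needs_rear g \<and> uncharged_at (rot3 (shift (-2) 0 g))"

text \<open>Two rich codewords split the 10 because each may already owe 14 as a side of the
  codeword in between. This keeps its total at 14 + 5 = 19.\<close>

definition far :: "int \<Rightarrow> int \<Rightarrow> int \<Rightarrow> int \<Rightarrow> config
    \<Rightarrow> int" where
  "far a b c d g = (if back_to_back g \<and> 78 \<le> charge (shift a b g) then
     (if 78 \<le> charge (shift c d g) then 5 else if charge (shift c d g) = 0 then 10 else 0) else 0)"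

definition far_server :: "config \<Rightarrow> int" where
  "far_server g = (if back_to_back g \<and> charge (shift (-4) 2 g) = 0
      \<and> charge (shift (-2) (-2) g) = 0 \<and> 78 \<le> charge (shift (-5) 0 g) then 10 else 0)"

text \<open>
  If three uncharged codewords share the hole, the vertex in front of the middle one is a rich
  codeword, its server.
\<close>

definition mid_pay :: "config \<Rightarrow> int" where
  "mid_pay g = (if uncharged_at g \<and> charge (shift 0 2 g) = 0 \<and> charge (shift 2 (-2) g) = 0
      \<and> 78 \<le> charge (shift 3 0 g) then 18 else 0)"

text \<open>
  If exactly two uncharged codewords share the hole, the missing 14 come from the recipient's own
  server, else from the server of its partner, else from an aide, a codeword at distance two from
  the poor server.
\<close>

definition end_left :: "config \<Rightarrow> bool" where
  "end_left g \<longleftrightarrow> uncharged_at g \<and> charge (shift 0 2 g) = 0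
      \<and> 0 < charge (shift 2 (-2) g)"

definition end_right :: "config \<Rightarrow> bool" where
  "end_right g \<longleftrightarrow> uncharged_at g \<and> charge (shift 2 (-2) g) = 0
      \<and> 0 < charge (shift 0 2 g)"

definition own_server :: "config \<Rightarrow> int" where
  "own_server g = (if (end_left g \<or> end_right g) \<and> 78 \<le> charge (shift 3 0 g) then 14 else 0)"

definition partner_left :: "config \<Rightarrow> int" where
  "partner_left g = (if end_left g \<and> charge (shift 3 0 g) < 78 \<and> 78 \<le> charge (shift 3
      (-1) g) then 14 else 0)"

definition partner_right :: "config \<Rightarrow> int" where
  "partner_right g = (if end_right g \<and> charge (shift 3 0 g) < 78 \<and> 78 \<le> charge (shift 2 1
      g) then 14 else 0)"

definition unserved_left :: "config \<Rightarrow> bool" where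
  "unserved_left g \<longleftrightarrow> end_left g \<and> charge (shift 3 0 g) < 78
      \<and> charge (shift 3 (-1) g) < 78"

definition unserved_right :: "config \<Rightarrow> bool" where
  "unserved_right g \<longleftrightarrow> end_right g \<and> charge (shift 3 0 g) < 78
      \<and> charge (shift 2 1 g) < 78"

definition own_aide_left where "own_aide_left g = (if unserved_left g \<and> g (3, 0)
    \<and> g (3, -2) then 14 else (0 :: int))"
definition partner_aide_left where "partner_aide_left g = (if unserved_left g \<and> g (3, -1)
    \<and> g (3, 1) then 14 else (0 :: int))"
definition own_aide_right where "own_aide_right g = (if unserved_right g \<and> g (3, 0)
    \<and> g (1, 2) then 14 else (0 :: int))"
definition partner_aide_right where "partner_aide_right g = (if unserved_right g \<and> g (2, 1)
    \<and> g (4, -1) then 14 else (0 :: int))"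

definition received :: "config \<Rightarrow> int" where
  "received g = side_left g + side_right g + rear (-2) 2 g + rear (-2) 0 g + rear 0 (-2) g
     + far (-4) 2 (-2) (-2) g + far (-2) (-2) (-4) 2 g + far_server g + mid_pay g + own_server g +
         partner_left g + partner_right g
     + own_aide_left g + partner_aide_left g + own_aide_right g + partner_aide_right g"

section \<open>Income of uncharged codewords\<close>

lemmas rule_defs = side_left_def side_right_def rear_def far_def far_server_def mid_pay_def
    own_server_def partner_left_def partner_right_def
  own_aide_left_def partner_aide_left_def own_aide_right_def partner_aide_right_def

lemma rules_nonneg: "0 \<le> side_left g" "0 \<le> side_right g" "0 \<le> rear a b g"
    "0 \<le> far a b c d g" "0 \<le> far_server g" "0 \<le> mid_pay g"
  "0 \<le> own_server g" "0 \<le> partner_left g" "0 \<le> partner_right g" "0 \<le> own_aide_left g"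
      "0 \<le> partner_aide_left g" "0 \<le> own_aide_right g" "0 \<le> partner_aide_right g"
  by (simp_all add: rule_defs)

lemma not_mid_range: "charge g \<le> 0 \<or> 78 \<le> charge g \<Longrightarrow> charge g < 78
    \<Longrightarrow> charge g = 0"
  using charge_nonneg[of g] by linarith

lemma received_ge_needs_rear:
  assumes "locating g" "needs_rear g"
  shows "10 \<le> rear (-2) 2 g + rear (-2) 0 g + rear 0 (-2) g + far (-4) 2 (-2) (-2) g + far (-2)
      (-2) (-4) 2 g + far_server g"
proof (cases "78 \<le> charge (shift (-2) 2 g) \<or> 78 \<le> charge (shift (-2) 0 g)
    \<or> 78 \<le> charge (shift 0 (-2) g)")
  case True
  then have "rear (-2) 2 g = 10 \<or> rear (-2) 0 g = 10 \<or> rear 0 (-2) g = 10"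
    using assms by (auto simp: rear_def)
  then show ?thesis
    using rules_nonneg(3)[of "-2" 2 g] rules_nonneg(3)[of "-2" 0 g] rules_nonneg(3)[of 0 "-2" g]
      rules_nonneg(4)[of "-4" 2 "-2" "-2" g] rules_nonneg(4)[of "-2" "-2" "-4" 2 g] rules_nonneg(5)[of g]
    by linarith
next
  case False
  have P: "uncharged_at g" and s1: "0 < charge (shift 0 2 g)" "charge (shift 0 2 g) < 78" and s5: "0 <
      charge (shift 2 (-2) g)" "charge (shift 2 (-2) g) < 78"
    using assms by (auto simp: needs_rear_def)
  have z: "charge (shift (-2) 2 g) = 0" "charge (shift (-2) 0 g) = 0" "charge (shift 0 (-2) g) = 0"
    using rear_not_poor[OF P] False not_mid_range by (meson not_le)+
  have c: "shift (-2) 2 g (0, 0)" "shift (-2) 0 g (0, 0)" "shift 0 (-2) g (0, 0)" using P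
    by (simp_all add: uncharged_at_def)
  have s: "some_rot uncharged_at (shift (-2) 2 g)" "some_rot uncharged_at (shift (-2) 0 g)"
      "some_rot uncharged_at (shift 0 (-2) g)"
    using charge_0_iff z c locating_shift[OF assms(1)] by blast+
  \<comment> \<open>With its hole in this direction, \<open>(-2, 2)\<close> would have the poor side
    \<open>(0, 2)\<close> among the three codewords behind it, against \<open>rear_not_poor\<close>.
    The next three facts are alike.\<close>
  have n1: "\<not> uncharged_at (rot2 (shift (-2) 2 g))"
  proof
    assume "uncharged_at (rot2 (shift (-2) 2 g))"
    from rear_not_poor(3)[OF this] have "charge (rot2 (shift 0 2 g)) \<le> 0
        \<or> 78 \<le> charge (rot2 (shift 0 2 g))"
      by (simp only: shift_rot shift_shift) (simp only: charge_rot; simp)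
    with s1 show False by simp
  qed
  have n2: "\<not> uncharged_at (rot3 (shift (-2) 2 g))"
  proof
    assume "uncharged_at (rot3 (shift (-2) 2 g))"
    from rear_not_poor(1)[OF this] have "charge (rot2 (shift 0 2 g)) \<le> 0
        \<or> 78 \<le> charge (rot2 (shift 0 2 g))"
      by (simp only: shift_rot shift_shift) (simp only: charge_rot; simp)
    with s1 show False by simp
  qed
  have n3: "\<not> uncharged_at (rot4 (shift 0 (-2) g))"
  proof
    assume "uncharged_at (rot4 (shift 0 (-2) g))"
    from rear_not_poor(2)[OF this] have "charge (rot2 (shift 2 (-2) g)) \<le> 0
        \<or> 78 \<le> charge (rot2 (shift 2 (-2) g))"
      by (simp only: shift_rot shift_shift) (simp only: charge_rot; simp)
    with s5 show False by simp
  qed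
  have n4: "\<not> uncharged_at (rot3 (shift 0 (-2) g))"
  proof
    assume "uncharged_at (rot3 (shift 0 (-2) g))"
    from rear_not_poor(1)[OF this] have "charge (rot2 (shift 2 (-2) g)) \<le> 0
        \<or> 78 \<le> charge (rot2 (shift 2 (-2) g))"
      by (simp only: shift_rot shift_shift) (simp only: charge_rot; simp)
    with s5 show False by simp
  qed
  have p2: "uncharged_at (rot (shift (-2) 2 g))"
    using s(1) n1 n2 P unfolding some_rot_def uncharged_at_def isolated_def by (simp; argo)
  have p4: "uncharged_at (rot5 (shift 0 (-2) g))"
    using s(3) n3 n4 P unfolding some_rot_def uncharged_at_def isolated_def by (simp; argo)
  \<comment> \<open>The holes just found make \<open>(-4, 2)\<close> and \<open>(-2, -2)\<close>
    codewords, so \<open>(-4, 0)\<close> is the only cell left for the hole of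
    \<open>(-2, 0)\<close>.\<close>
  have p3: "uncharged_at (rot3 (shift (-2) 0 g))"
    using s(2) p2 p4 P unfolding some_rot_def uncharged_at_def isolated_def by (simp; argo)
  then have back_to_back: "back_to_back g" using assms by (simp add: back_to_back_def)
  \<comment> \<open>The codeword \<open>(-4, 2)\<close> is both behind \<open>(-2, 2)\<close>, hence
    not poor, and a side of \<open>(-2, 0)\<close>. If it and its counterpart
    \<open>(-2, -2)\<close> are uncharged, \<open>server_mid\<close> applies to
    \<open>(-2, 0)\<close>.\<close>
  have x: "charge (shift (-4) 2 g) \<le> 0 \<or> 78 \<le> charge (shift (-4) 2 g)"
    using rear_not_poor(2)[OF p2] by (simp only: shift_rot shift_shift) (simp only: charge_rot; simp)
  have x': "charge (shift (-2) (-2) g) \<le> 0 \<or> 78 \<le> charge (shift (-2) (-2) g)"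
    using rear_not_poor(3)[OF p4] by (simp only: shift_rot shift_shift) (simp only: charge_rot; simp)
  show ?thesis
  proof (cases "78 \<le> charge (shift (-4) 2 g) \<or> 78 \<le> charge (shift (-2) (-2) g)")
    case True
    then show ?thesis
      using back_to_back x x' False charge_nonneg[of "shift (-4) 2 g"] charge_nonneg[of "shift (-2) (-2) g"]
      by (auto simp: far_def far_server_def rear_def)
  next
    case n: False
    then have z2: "charge (shift (-4) 2 g) = 0" "charge (shift (-2) (-2) g) = 0"
      using x x' not_mid_range by (meson not_le)+
    let ?f = "rot3 (shift (-2) 0 g)"
    have "78 \<le> charge (shift 3 0 ?f)"
    proof (rule server_mid)
      show "locating ?f" using assms by (simp add: locating_rot locating_shift)
      show "uncharged_at ?f" by (fact p3)
      show "charge (shift 0 2 ?f) = 0" using z2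
        by (simp only: shift_rot shift_shift) (simp only: charge_rot; simp)
      show "charge (shift 2 (-2) ?f) = 0" using z2
        by (simp only: shift_rot shift_shift) (simp only: charge_rot; simp)
    qed
    then have "78 \<le> charge (shift (-5) 0 g)"
      by (simp only: shift_rot shift_shift) (simp only: charge_rot; simp)
    then show ?thesis using back_to_back z2 False by (auto simp: far_def far_server_def rear_def)
  qed
qed

lemma received_ge:
  assumes "locating g" "uncharged_at g"
  shows "18 \<le> received g"
proof -
  note nn = rules_nonneg(1,2,5-)[of g] rules_nonneg(3)[of "-2" 2 g] rules_nonneg(3)[of "-2" 0 g]
      rules_nonneg(3)[of 0 "-2" g]
      rules_nonneg(4)[of "-4" 2 "-2" "-2" g] rules_nonneg(4)[of "-2" "-2" "-4" 2 g]
  have z: "0 \<le> charge (shift 0 2 g)" "0 \<le> charge (shift 2 (-2) g)" by (rule charge_nonneg)+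
  \<comment> \<open>The five cases collect 14 + 4, then 4 + 4 + 10, then 18, and twice 4 +
    14.\<close>
  consider "0 < charge (shift 0 2 g)" "0 < charge (shift 2 (-2) g)" "78 \<le> charge (shift 0 2 g)
      \<or> 78 \<le> charge (shift 2 (-2) g)"
    | "needs_rear g" | "charge (shift 0 2 g) = 0" "charge (shift 2 (-2) g) = 0" | "end_left g" | "end_right g"
    using z assms unfolding needs_rear_def end_left_def end_right_def by linarith
  then show ?thesis
  proof cases
    case 1
    then have "18 \<le> side_left g + side_right g" using assms by (auto simp: side_left_def side_right_def)
    then show ?thesis using nn unfolding received_def by linarith
  next
    case 2
    then have "8 \<le> side_left g + side_right g" using assms
      by (auto simp: side_left_def side_right_def needs_rear_def)
    then show ?thesis using nn received_ge_needs_rear[OF assms(1) 2] unfolding received_def by linarith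
  next
    case 3
    then have "18 \<le> mid_pay g" using server_mid assms by (simp add: mid_pay_def)
    then show ?thesis using nn unfolding received_def by linarith
  next
    case 4
    have "4 \<le> side_right g" using 4 by (simp add: end_left_def side_right_def)
    moreover have "14 \<le> own_server g + partner_left g + own_aide_left g + partner_aide_left g"
      using 4 server_pair_left[OF assms]
      by (auto simp: own_server_def partner_left_def own_aide_left_def partner_aide_left_def
          unserved_left_def end_left_def)
    ultimately show ?thesis using nn unfolding received_def by linarith
  next
    case 5
    have "4 \<le> side_left g" using 5 by (simp add: end_right_def side_left_def)
    moreover have "14 \<le> own_server g + partner_right g + own_aide_right g + partner_aide_right g"
      using 5 server_pair_right[OF assms]
      by (auto simp: own_server_def partner_right_def own_aide_right_def partner_aide_right_def
          unserved_right_def end_right_def)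
    ultimately show ?thesis using nn unfolding received_def by linarith
  qed
qed

section \<open>Capacity of the donors\<close>

text \<open>
  The same payments seen from a donor at the origin, summed over the recipients that lie in
  direction \<open>(1, 0)\<close>. A hub pays under the side, rear and far rules.
\<close>

definition hub_paid :: "config \<Rightarrow> int" where
  "hub_paid g = side_left (rot2 (shift 2 0 g)) + side_right (rot4 (shift 2 0 g))
    + rear (-2) 2 (rot (shift 2 0 g)) + rear (-2) 0 (shift 2 0 g) + rear 0 (-2) (rot5 (shift 2 0 g))
    + far (-4) 2 (-2) (-2) (rot (shift 2 2 g)) + far (-2) (-2) (-4) 2 (rot5 (shift 4 (-2) g))"

definition serve_paid :: "config \<Rightarrow> int" where
  "serve_paid g = far_server (shift 5 0 g) + mid_pay (rot3 (shift 3 0 g)) + own_server (rot3 (shift 3 0 g))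
    + partner_left (rot4 (shift 1 2 g)) + partner_right (rot2 (shift 3 (-2) g))"

definition aide_paid :: "config \<Rightarrow> int" where
  "aide_paid g = own_aide_left (rot3 (shift 3 (-2) g)) + partner_aide_left (rot4 (shift (-1) 4 g))
    + own_aide_right (rot3 (shift 1 2 g)) + partner_aide_right (rot2 (shift 3 (-4) g))"

text \<open>
  The constellations in direction \<open>(1, 0)\<close> that cause a payment: clients of a hub, the
  recipients around the hole \<open>(1, 0)\<close> of a server, and the pairs helped by an aide.
\<close>

definition client_rear :: "config \<Rightarrow> bool" where
  "client_rear g \<longleftrightarrow> uncharged_at (shift 2 0 g) \<or> uncharged_at (rot (shift 2 0 g))
      \<or> uncharged_at (rot5 (shift 2 0 g))"
definition client_left :: "config \<Rightarrow> bool" where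
  "client_left g \<longleftrightarrow> uncharged_at (rot2 (shift 2 0 g))"
definition client_right :: "config \<Rightarrow> bool" where
  "client_right g \<longleftrightarrow> uncharged_at (rot4 (shift 2 0 g))"
definition hole_mid :: "config \<Rightarrow> bool" where
  "hole_mid g \<longleftrightarrow> uncharged_at (rot3 (shift 3 0 g))"
definition hole_left :: "config \<Rightarrow> bool" where
  "hole_left g \<longleftrightarrow> uncharged_at (rot4 (shift 1 2 g))"
definition hole_right :: "config \<Rightarrow> bool" where
  "hole_right g \<longleftrightarrow> uncharged_at (rot2 (shift 3 (-2) g))"
definition aide_right :: "config \<Rightarrow> bool" where
  "aide_right g \<longleftrightarrow> uncharged_at (rot3 (shift 3 (-2) g))
      \<and> uncharged_at (rot2 (shift 3 (-4) g)) \<and> g (0, -2) \<and> charge (shift 0 (-2) g) < 78"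
definition aide_left :: "config \<Rightarrow> bool" where
  "aide_left g \<longleftrightarrow> uncharged_at (rot3 (shift 1 2 g))
      \<and> uncharged_at (rot4 (shift (-1) 4 g)) \<and> g (-2, 2) \<and> charge (shift (-2) 2 g) < 78"

section \<open>Cells forced by clients, holes and aides\<close>

lemma client_cells:
  "client_rear g \<Longrightarrow> \<not> g (1, 0) \<and> \<not> g (0, 1) \<and> \<not> g (1, -1)
      \<and> g (2, 0) \<and> \<not> g (1, 1) \<and> \<not> g (2, -1) \<and> \<not> g (3, -1)
      \<and> \<not> g (2, 1)
     \<and> g (0, 2) \<and> g (2, -2)"
  "client_left g \<Longrightarrow> \<not> g (1, 0) \<and> \<not> g (0, 1) \<and> \<not> g (1, -1)
      \<and> g (2, 0) \<and> \<not> g (1, 1) \<and> \<not> g (2, -1) \<and> \<not> g (3, -1)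
      \<and> \<not> g (2, 1)
     \<and> \<not> g (0, 2) \<and> g (2, -2) \<and> g (2, 2) \<and> g (4, -2)"
  "client_right g \<Longrightarrow> \<not> g (1, 0) \<and> \<not> g (0, 1) \<and> \<not> g (1, -1)
      \<and> g (2, 0) \<and> \<not> g (1, 1) \<and> \<not> g (2, -1) \<and> \<not> g (3, -1)
      \<and> \<not> g (2, 1)
     \<and> g (0, 2) \<and> \<not> g (2, -2) \<and> g (2, 2) \<and> g (4, -2)"
  by (auto simp: client_rear_def client_left_def client_right_def uncharged_at_def isolated_def)

lemma hole_cells:
  "hole_mid g \<Longrightarrow> \<not> g (1, 0) \<and> \<not> g (2, 0) \<and> \<not> g (1, 1)
      \<and> \<not> g (2, -1) \<and> g (1, 2) \<and> g (3, -2) \<and> \<not> g (3, -1) \<and> \<not> g (2, 1)"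
  "hole_left g \<Longrightarrow> \<not> g (0, 1) \<and> \<not> g (0, 2) \<and> g (-1, 2)"
  "hole_right g \<Longrightarrow> \<not> g (1, -1) \<and> \<not> g (2, -2) \<and> g (1, -2)"
  by (auto simp: hole_mid_def hole_left_def hole_right_def uncharged_at_def isolated_def)

lemma aide_cells:
  "aide_right g \<Longrightarrow> g (1, 0) \<and> \<not> g (0, -1) \<and> \<not> g (1, -1)
      \<and> \<not> g (1, -2) \<and> \<not> g (2, -1) \<and> \<not> g (2, -2) \<and> g (0, -2) \<and>
     \<not> g (-1, -1) \<and> \<not> g (-1, -2) \<and> \<not> g (0, -3) \<and> \<not> g (1, -3)
         \<and> \<not> g (2, -4)"
  "aide_left g \<Longrightarrow> g (1, 0) \<and> \<not> g (-1, 1) \<and> \<not> g (0, 1)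
      \<and> \<not> g (-1, 2) \<and> \<not> g (1, 1) \<and> \<not> g (0, 2) \<and> g (-2, 2) \<and>
     \<not> g (-2, 1) \<and> \<not> g (-3, 2) \<and> \<not> g (-3, 3) \<and> \<not> g (-2, 3)
         \<and> \<not> g (-2, 4)"
  using charge_lt_78(1)[of "shift 0 (-2) g"] charge_lt_78(1)[of "shift (-2) 2 g"]
  by (auto simp: aide_right_def aide_left_def uncharged_at_def isolated_def)

section \<open>Payments in a single direction\<close>

lemma charge_nonisolated: "g (0, 0) \<Longrightarrow> \<not> isolated g \<Longrightarrow> 78 \<le> charge g"
  using charge_lt_78(1)[of g] by fastforce

lemma hub_paid_le: "hub_paid g \<le> 10 * of_bool (client_rear g) + 19 * of_bool (client_left g) + 19 *
    of_bool (client_right g)"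
proof -
  have b: "rear (-2) 2 (rot (shift 2 0 g)) + rear (-2) 0 (shift 2 0 g) + rear 0 (-2) (rot5 (shift 2 0
      g)) \<le> 10 * of_bool (client_rear g)"
  proof -
    have "\<not> (uncharged_at (shift 2 0 g) \<and> uncharged_at (rot (shift 2 0 g)))"
        "\<not> (uncharged_at (shift 2 0 g) \<and> uncharged_at (rot5 (shift 2 0 g)))"
      "\<not> (uncharged_at (rot (shift 2 0 g)) \<and> uncharged_at (rot5 (shift 2 0 g)))"
      by (auto simp: uncharged_at_def)
    then show ?thesis by (auto simp: rear_def needs_rear_def client_rear_def)
  qed
  have p: "side_left (rot2 (shift 2 0 g)) + far (-2) (-2) (-4) 2 (rot5 (shift 4 (-2) g)) \<le> 19 *
      of_bool (client_left g)"
  proof -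
    \<comment> \<open>The side rule and the far rule look at the same third codeword. If it is
      charged, they cost at most 14 and 5; if not, at most 4 and 10.\<close>
    have e: "charge (shift 2 (-2) (rot2 (shift 2 0 g))) = charge (shift (-4) 2 (rot5 (shift 4 (-2) g)))"
      by (simp add: shift_rot shift_shift)
    have "rot3 (shift (-2) 0 (rot5 (shift 4 (-2) g)))  = rot2 (shift 2 0 g)"
      by (simp add: shift_rot shift_shift rot_6)
    then have "back_to_back (rot5 (shift 4 (-2) g)) \<Longrightarrow> client_left g"
      by (simp add: back_to_back_def client_left_def)
    then show ?thesis by (auto simp: far_def side_left_def client_left_def e)
  qed
  have m: "side_right (rot4 (shift 2 0 g)) + far (-4) 2 (-2) (-2) (rot (shift 2 2 g)) \<le> 19 *
      of_bool (client_right g)"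
  proof -
    have e: "charge (shift 0 2 (rot4 (shift 2 0 g))) = charge (shift (-2) (-2) (rot (shift 2 2 g)))"
      by (simp add: shift_rot shift_shift)
    have "rot3 (shift (-2) 0 (rot (shift 2 2 g))) = rot4 (shift 2 0 g)"
      by (simp add: shift_rot shift_shift)
    then have "back_to_back (rot (shift 2 2 g)) \<Longrightarrow> client_right g"
      by (simp add: back_to_back_def client_right_def)
    then show ?thesis by (auto simp: far_def side_right_def client_right_def e)
  qed
  show ?thesis using b p m unfolding hub_paid_def by linarith
qed

text \<open>Here 56 is 10 as far server, 18 for the middle recipient and 14 for each of its two
  partners, and 28 is 14 for each member of a pair. A codeword at \<open>(1, -1)\<close> or
  \<open>(0, 1)\<close> is adjacent to the donor, hence rich, and serves the partner in its
  place.\<close>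

definition serve_cap :: "config \<Rightarrow> int" where
  "serve_cap g = (if hole_mid g \<and> hole_left g \<and> hole_right g then 56 else if hole_mid g
      \<and> hole_left g then (if g (1, -1) then 14 else 28)
      else if hole_mid g \<and> hole_right g then (if g (0, 1) then 14 else 28) else 0)"

lemma serve_paid_le:
  assumes "locating g" "g (0, 0)"
  shows "serve_paid g \<le> serve_cap g"
proof -
  let ?c = "rot3 (shift 3 0 g)" and ?p = "rot4 (shift 1 2 g)" and ?m = "rot2 (shift 3 (-2) g)"
  have L: "locating ?c" "locating ?p" "locating ?m" using assms by (auto simp: locating_shift locating_rot)
  have c1: "hole_right g" if "hole_mid g" "charge (shift 0 2 ?c) = 0"
    using side_left_hole[OF L(1)] that by (simp add: hole_mid_def hole_right_def shift_rot shift_shift rot_6)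
  have c5: "hole_left g" if "hole_mid g" "charge (shift 2 (-2) ?c) = 0"
    using side_right_hole[OF L(1)] that by (simp add: hole_mid_def hole_left_def shift_rot shift_shift rot_6)
  have p1: "hole_mid g" if "hole_left g" "charge (shift 0 2 ?p) = 0"
    using side_left_hole[OF L(2)] that by (simp add: hole_mid_def hole_left_def shift_rot shift_shift rot_6)
  have m5: "hole_mid g" if "hole_right g" "charge (shift 2 (-2) ?m) = 0"
    using side_right_hole[OF L(3)] that by (simp add: hole_mid_def hole_right_def shift_rot shift_shift rot_6)
  have f0: "hole_mid g \<and> hole_left g \<and> hole_right g" if "far_server (shift 5 0 g) \<noteq> 0"
  proof -
    have o: "back_to_back (shift 5 0 g)" and z: "charge (shift 1 2 g) = 0" "charge (shift 3 (-2) g) = 0"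
      using that by (auto simp: far_server_def shift_shift split: if_splits)
    then have "hole_mid g" by (simp add: back_to_back_def hole_mid_def shift_shift)
    moreover have "charge (shift 0 2 ?c) = 0" "charge (shift 2 (-2) ?c) = 0" using z
      by (simp_all add: shift_rot shift_shift)
    ultimately show ?thesis using c1 c5 by blast
  qed
  have d1: "\<not> g (1, -1)" if "partner_left ?p \<noteq> 0"
  proof
    assume "g (1, -1)"
    then have "78 \<le> charge (shift 1 (-1) g)"
      using assms by (intro charge_nonisolated) (auto simp: isolated_def)
    then show False using that by (auto simp: partner_left_def shift_rot shift_shift split: if_splits)
  qed
  have d5: "\<not> g (0, 1)" if "partner_right ?m \<noteq> 0"
  proof
    assume "g (0, 1)"
    then have "78 \<le> charge (shift 0 1 g)"
      using assms by (intro charge_nonisolated) (auto simp: isolated_def)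
    then show False using that by (auto simp: partner_right_def shift_rot shift_shift split: if_splits)
  qed
  have a: "far_server (shift 5 0 g) \<le> (if hole_mid g \<and> hole_left g
      \<and> hole_right g then 10 else 0)"
    using f0 by (auto simp: far_server_def)
  have b: "mid_pay ?c \<le> (if hole_mid g \<and> hole_left g \<and> hole_right g then 18 else 0)"
    using c1 c5 by (auto simp: mid_pay_def hole_mid_def)
  have e1: "end_left ?c \<Longrightarrow> hole_mid g \<and> hole_right g"
      "end_right ?c \<Longrightarrow> hole_mid g \<and> hole_left g"
    using c1 c5 by (auto simp: end_left_def end_right_def hole_mid_def)
  have zz: "charge (shift 0 2 ?c) = 0" if "hole_right g"
    using uncharged_at_charge[of ?m] that by (simp add: hole_right_def shift_rot shift_shift)
  have zy: "charge (shift 2 (-2) ?c) = 0" if "hole_left g"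
    using uncharged_at_charge[of ?p] that by (simp add: hole_left_def shift_rot shift_shift)
  have e: "own_server ?c \<le> (if hole_mid g \<and> hole_left g \<and> hole_right g then 0 else if
      hole_mid g \<and> (hole_left g \<or> hole_right g) then 14 else 0)"
  proof (cases "own_server ?c = 0")
    case False
    then have "end_left ?c \<or> end_right ?c" by (auto simp: own_server_def split: if_splits)
    then have "hole_mid g \<and> (hole_left g \<or> hole_right g) \<and> \<not> (hole_left g
        \<and> hole_right g)"
    proof
      assume x: "end_left ?c"
      then have "\<not> hole_left g" using zy unfolding end_left_def by force
      then show ?thesis using e1(1)[OF x] by blast
    next
      assume x: "end_right ?c"
      then have "\<not> hole_right g" using zz unfolding end_right_def by force
      then show ?thesis using e1(2)[OF x] by blast
    qed
    then show ?thesis by (simp add: own_server_def)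
  qed simp
  have d: "partner_left ?p \<le> (if hole_mid g \<and> hole_left g \<and> \<not> g (1, -1) then 14 else 0)"
  proof (cases "partner_left ?p = 0")
    case False
    then have "end_left ?p" by (auto simp: partner_left_def split: if_splits)
    then have "hole_mid g" "hole_left g" using p1 by (auto simp: end_left_def hole_left_def)
    with d1[OF False] show ?thesis by (simp add: partner_left_def)
  qed simp
  have d': "partner_right ?m \<le> (if hole_mid g \<and> hole_right g \<and> \<not> g (0, 1) then 14 else 0)"
  proof (cases "partner_right ?m = 0")
    case False
    then have "end_right ?m" by (auto simp: partner_right_def split: if_splits)
    then have "hole_mid g" "hole_right g" using m5 by (auto simp: end_right_def hole_right_def)
    with d5[OF False] show ?thesis by (simp add: partner_right_def)
  qed simp
  show ?thesis
    using a b e d d' unfolding serve_paid_def serve_cap_def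
    by (cases "hole_mid g"; cases "hole_left g"; cases "hole_right g"; cases "g (1, -1)"; cases "g (0,
        1)"; simp only: if_True if_False simp_thms; linarith)
qed

text \<open>An aide supports both members of a pair around one hole, with 14 each.\<close>

lemma aide_paid_le:
  assumes "locating g"
  shows "aide_paid g \<le> 28 * of_bool (aide_right g) + 28 * of_bool (aide_left g)"
proof -
  let ?a = "rot3 (shift 3 (-2) g)" and ?a' = "rot2 (shift 3 (-4) g)"
  let ?b = "rot3 (shift 1 2 g)" and ?b' = "rot4 (shift (-1) 4 g)"
  have L: "locating ?a" "locating ?a'" "locating ?b" "locating ?b'" using assms
    by (auto simp: locating_shift locating_rot)
  have 1: "aide_right g" if "own_aide_left ?a \<noteq> 0"
    using that side_left_hole[OF L(1)]
    unfolding own_aide_left_def unserved_left_def end_left_def aide_right_def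
    by (auto simp: shift_rot shift_shift rot_6 split: if_splits)
  have 2: "aide_right g" if "partner_aide_right ?a' \<noteq> 0"
    using that side_right_hole[OF L(2)]
    unfolding partner_aide_right_def unserved_right_def end_right_def aide_right_def
    by (auto simp: shift_rot shift_shift rot_6 split: if_splits)
  have 3: "aide_left g" if "own_aide_right ?b \<noteq> 0"
    using that side_right_hole[OF L(3)]
    unfolding own_aide_right_def unserved_right_def end_right_def aide_left_def
    by (auto simp: shift_rot shift_shift rot_6 split: if_splits)
  have 4: "aide_left g" if "partner_aide_left ?b' \<noteq> 0"
    using that side_left_hole[OF L(4)]
    unfolding partner_aide_left_def unserved_left_def end_left_def aide_left_def
    by (auto simp: shift_rot shift_shift rot_6 split: if_splits)
  have b: "own_aide_left ?a \<le> 14" "partner_aide_right ?a' \<le> 14" "own_aide_right ?b \<le> 14"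
      "partner_aide_left ?b' \<le> 14"
    by (auto simp: own_aide_left_def partner_aide_left_def own_aide_right_def partner_aide_right_def)
  have "own_aide_left ?a \<le> 14 * of_bool (aide_right g)" using 1 b by (cases "own_aide_left ?a = 0") auto
  moreover have "partner_aide_right ?a' \<le> 14 * of_bool (aide_right g)" using 2 b
    by (cases "partner_aide_right ?a' = 0") auto
  moreover have "own_aide_right ?b \<le> 14 * of_bool (aide_left g)" using 3 b
    by (cases "own_aide_right ?b = 0") auto
  moreover have "partner_aide_left ?b' \<le> 14 * of_bool (aide_left g)" using 4 b
    by (cases "partner_aide_left ?b' = 0") auto
  ultimately show ?thesis unfolding aide_paid_def by linarith
qed

text \<open>Separation of two neighbours of a codeword at angles of 60, 120 and 180 degrees. In
  particular they cannot both be private.\<close>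

lemma locating_ring:
  assumes "locating g" "g (0, 0)"
  shows "\<not> g (1, 0) \<and> \<not> g (0, 1) \<longrightarrow> g (2, 0) \<or> g (2, -1)
      \<or> g (1, -1) \<or> g (0, 2) \<or> g (-1, 2) \<or> g (-1, 1)"
    and "\<not> g (1, 0) \<and> \<not> g (-1, 1) \<longrightarrow> g (2, 0) \<or> g (1, 1)
        \<or> g (2, -1) \<or> g (1, -1) \<or> g (-2, 2) \<or> g (-2, 1) \<or> g (-1, 2) \<or> g (-1, 0)"
    and "\<not> g (1, 0) \<and> \<not> g (-1, 0) \<longrightarrow> g (2, 0) \<or> g (1, 1)
        \<or> g (2, -1) \<or> g (1, -1) \<or> g (0, 1) \<or> g (-2, 0) \<or> g (-1, -1) \<or> g (-2, 1)
       \<or> g (-1, 1) \<or> g (0, -1)"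
  using locating_D[OF assms(1), of 1 0] locating_D[OF assms(1), of "-1" 0] unfolding locating_at_def
  by (simp; argo)+

section \<open>Capacity of isolated codewords\<close>

lemma hub_arith:
  assumes "b0 \<longrightarrow> a0 \<and> a1 \<and> a5" "p0 \<longrightarrow> a0 \<and> \<not> a1
      \<and> a5" "m0 \<longrightarrow> a0 \<and> a1 \<and> \<not> a5"
    "b1 \<longrightarrow> a1 \<and> a2 \<and> a0" "p1 \<longrightarrow> a1 \<and> \<not> a2 \<and> a0"
        "m1 \<longrightarrow> a1 \<and> a2 \<and> \<not> a0"
    "b2 \<longrightarrow> a2 \<and> a3 \<and> a1" "p2 \<longrightarrow> a2 \<and> \<not> a3 \<and> a1"
        "m2 \<longrightarrow> a2 \<and> a3 \<and> \<not> a1"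
    "b3 \<longrightarrow> a3 \<and> a4 \<and> a2" "p3 \<longrightarrow> a3 \<and> \<not> a4 \<and> a2"
        "m3 \<longrightarrow> a3 \<and> a4 \<and> \<not> a2"
    "b4 \<longrightarrow> a4 \<and> a5 \<and> a3" "p4 \<longrightarrow> a4 \<and> \<not> a5 \<and> a3"
        "m4 \<longrightarrow> a4 \<and> a5 \<and> \<not> a3"
    "b5 \<longrightarrow> a5 \<and> a0 \<and> a4" "p5 \<longrightarrow> a5 \<and> \<not> a0 \<and> a4"
        "m5 \<longrightarrow> a5 \<and> a0 \<and> \<not> a4"
    "\<not> (p0 \<and> m2 \<and> b3 \<and> b4 \<and> b5)"
    "\<not> (p1 \<and> m3 \<and> b4 \<and> b5 \<and> b0)"
    "\<not> (p2 \<and> m4 \<and> b5 \<and> b0 \<and> b1)"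
    "\<not> (p3 \<and> m5 \<and> b0 \<and> b1 \<and> b2)"
    "\<not> (p4 \<and> m0 \<and> b1 \<and> b2 \<and> b3)"
    "\<not> (p5 \<and> m1 \<and> b2 \<and> b3 \<and> b4)"
    "\<not> (p0 \<and> m2 \<and> p3 \<and> m5)"
    "\<not> (p1 \<and> m3 \<and> p4 \<and> m0)"
    "\<not> (p2 \<and> m4 \<and> p5 \<and> m1)"
  shows "(10 * of_bool b0 + 19 * of_bool p0 + 19 * of_bool m0) + (10 * of_bool b1 + 19 * of_bool p1 +
      19 * of_bool m1) + (10 * of_bool b2 + 19 * of_bool p2 + 19 * of_bool m2) + (10 * of_bool b3 + 19
      * of_bool p3 + 19 * of_bool m3) + (10 * of_bool b4 + 19 * of_bool p4 + 19 * of_bool m4) + (10 *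
      of_bool b5 + 19 * of_bool p5 + 19 * of_bool m5) \<le> (60 :: int)"
  using assms by (smt (verit) of_bool_eq(1) of_bool_eq(2))

definition hub_cap :: "config \<Rightarrow> int" where
  "hub_cap g = 10 * of_bool (client_rear g) + 19 * of_bool (client_left g) + 19 * of_bool (client_right g)"

definition client :: "config \<Rightarrow> bool" where
  "client g \<longleftrightarrow> client_rear g \<or> client_left g \<or> client_right g"

lemma hub_cap_le: "hub_cap g \<le> 19 * of_bool (client g)" "\<not> client_left g \<Longrightarrow>
    \<not> client_right g \<Longrightarrow> hub_cap g \<le> 10"
  using client_cells[of g] by (auto simp: hub_cap_def client_def)

lemma hub_cap_0: "\<not> client g \<Longrightarrow> hub_cap g = 0"
  by (simp add: hub_cap_def client_def)

lemma client_ring: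
  "client g \<Longrightarrow> \<not> g (1, 0) \<and> \<not> g (0, 1) \<and> \<not> g (1, -1)
      \<and> g (2, 0) \<and> \<not> g (1, 1) \<and> \<not> g (2, -1) \<and> \<not> g (3, -1)
      \<and> \<not> g (2, 1)"
  "client_left g \<Longrightarrow> client g" "client_right g \<Longrightarrow> client g"
  "client g \<Longrightarrow> \<not> client_left g \<Longrightarrow> g (0, 2)"
  "client g \<Longrightarrow> \<not> client_right g \<Longrightarrow> g (2, -2)"
  "client_left g \<Longrightarrow> \<not> g (0, 2) \<and> g (2, 2)" "client_right g \<Longrightarrow>
      \<not> g (2, -2) \<and> g (4, -2)"
  using client_cells[of g] by (auto simp: client_def)

lemma client_ring_imp:
  "(client g \<longrightarrow> \<not> g (1, 0) \<and> \<not> g (0, 1) \<and> \<not> g (1, -1)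
      \<and> g (2, 0) \<and> \<not> g (1, 1) \<and> \<not> g (2, -1) \<and> \<not> g (3, -1)
      \<and> \<not> g (2, 1))
   \<and> (client_left g \<longrightarrow> client g \<and> \<not> g (0, 2) \<and> g (2, 2))
       \<and> (client_right g \<longrightarrow> client g \<and> \<not> g (2, -2) \<and> g (4, -2))
   \<and> (client g \<and> \<not> client_left g \<longrightarrow> g (0, 2)) \<and> (client g
       \<and> \<not> client_right g \<longrightarrow> g (2, -2))"
  using client_ring[of g] by blast

lemma hole_cells_imp:
  "(hole_mid g \<longrightarrow> \<not> g (1, 0) \<and> \<not> g (2, 0) \<and> \<not> g (1, 1)
      \<and> \<not> g (2, -1) \<and> g (1, 2) \<and> g (3, -2) \<and> \<not> g (3, -1) \<and> \<not> g (2, 1))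
  \<and> (hole_left g \<longrightarrow> \<not> g (0, 1) \<and> \<not> g (0, 2) \<and> g (-1, 2))
      \<and> (hole_right g \<longrightarrow> \<not> g (1, -1) \<and> \<not> g (2, -2) \<and> g (1, -2))"
  using hole_cells[of g] by blast

definition serving :: "config \<Rightarrow> bool" where
  "serving g \<longleftrightarrow> hole_mid g \<and> (hole_left g \<or> hole_right g)"

lemma serve_cap_le: "serve_cap g \<le> 56" "\<not> serving g \<Longrightarrow> serve_cap g = 0"
    "\<not> (hole_mid g \<and> hole_left g \<and> hole_right g) \<Longrightarrow> serve_cap g \<le> 28"
  by (auto simp: serve_cap_def serving_def)

lemma aide_cells_imp:
  "(aide_right g \<longrightarrow> g (1, 0) \<and> \<not> g (0, -1) \<and> \<not> g (1, -1)
      \<and> \<not> g (1, -2) \<and> \<not> g (2, -1) \<and> \<not> g (2, -2) \<and> g (0, -2) \<and>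
     \<not> g (-1, -1) \<and> \<not> g (-1, -2) \<and> \<not> g (0, -3) \<and> \<not> g (1, -3)
         \<and> \<not> g (2, -4))
  \<and> (aide_left g \<longrightarrow> g (1, 0) \<and> \<not> g (-1, 1) \<and> \<not> g (0, 1)
      \<and> \<not> g (-1, 2) \<and> \<not> g (1, 1) \<and> \<not> g (0, 2) \<and> g (-2, 2) \<and>
     \<not> g (-2, 1) \<and> \<not> g (-3, 2) \<and> \<not> g (-3, 3) \<and> \<not> g (-2, 3)
         \<and> \<not> g (-2, 4))"
  using aide_cells[of g] by blast

text \<open>For an isolated codeword the hole that it serves is a private neighbour, and it has at
  most one of these.\<close>

lemma serving_unique_isolated:
  assumes "locating g" "g (0, 0)" "isolated g" "serving g"
  shows "\<not> serving (rot g)" "\<not> serving (rot2 g)" "\<not> serving (rot3 g)" "\<not> serving (rot4 g)"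
    "\<not> serving (rot5 g)"
  using assms(3,4) locating_ring[OF assms(1,2)] locating_ring[OF locating_rot[OF locating_rot[OF assms(1)]]]
    locating_ring(2)[of "rot4 g"] hole_cells_imp[of "g"] hole_cells_imp[of "rot g"]
        hole_cells_imp[of "rot2 g"] hole_cells_imp[of "rot3 g"] hole_cells_imp[of "rot4 g"]
        hole_cells_imp[of "rot5 g"] locating_rot[OF locating_rot[OF locating_rot[OF locating_rot[OF
        assms(1)]]]] assms(2)
  unfolding serving_def isolated_def by (simp; argo)+

lemma isolated_serving_clients:
  assumes "locating g" "g (0, 0)" "isolated g" "serving g"
  shows "\<not> client g" "\<not> client (rot g)" "\<not> client (rot5 g)"
    "hole_left g \<longrightarrow> \<not> client (rot2 g)" "hole_right g
        \<longrightarrow> \<not> client (rot4 g)"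
    "hole_left g \<and> client (rot3 g) \<longrightarrow> irregular (rot2 g)
        \<and> \<not> client_right (rot3 g)"
    "hole_right g \<and> client (rot3 g) \<longrightarrow> irregular (rot4 g)
        \<and> \<not> client_left (rot3 g)"
  using assms(3,4) locating_ring(1)[of "rot g"] locating_ring(1)[of "rot4 g"] locating_rot[OF assms(1)]
      locating_rot[OF locating_rot[OF locating_rot[OF locating_rot[OF assms(1)]]]] assms(2)
   hole_cells_imp[of "g"] client_ring_imp[of "g"] client_ring_imp[of "rot g"]
       client_ring_imp[of "rot2 g"] client_ring_imp[of "rot3 g"] client_ring_imp[of "rot4 g"]
       client_ring_imp[of "rot5 g"]
  unfolding serving_def isolated_def irregular_def by (simp; argo)+

text \<open>A charge of 78 leaves 60 to spend. After 56 for three recipients no client could be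
  paid, but the only possible client, in the opposite direction, comes with two irregular neighbours
  and a charge of at least 156. After 28 for a pair, the clients cost at most 10 + 19.\<close>

lemma capacity_isolated_serving:
  assumes "locating g" "g (0, 0)" "isolated g" "serving g" "78 \<le> charge g"
  shows "cyc hub_cap g + cyc serve_cap g \<le> charge g - 18"
proof -
  note A = isolated_serving_clients[OF assms(1-4)] and U = serving_unique_isolated[OF assms(1-4)]
  have S: "cyc serve_cap g = serve_cap g" using U serve_cap_le(2) by (simp add: cyc_def)
  have V: "cyc hub_cap g = hub_cap (rot2 g) + hub_cap (rot3 g) + hub_cap (rot4 g)"
    using A(1-3) hub_cap_0 by (simp add: cyc_def)
  consider (both) "hole_left g" "hole_right g" | (P) "hole_left g" "\<not> hole_right g" | (M)
      "hole_right g" "\<not> hole_left g"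
    using assms(4) by (auto simp: serving_def)
  then show ?thesis
  proof cases
    case both
    have v: "hub_cap (rot2 g) = 0" "hub_cap (rot4 g) = 0" using A both hub_cap_0 by auto
    show ?thesis
    proof (cases "client (rot3 g)")
      case True
      then have i: "irregular (rot2 g)" "irregular (rot4 g)" using A both by auto
      have "156 \<le> charge g" using i assms(2,3) by (simp add: charge_isolated cyc_def)
      then show ?thesis using S V v hub_cap_le(1)[of "rot3 g"] serve_cap_le(1)[of g] True by simp
    next
      case False
      then show ?thesis using S V v hub_cap_0 serve_cap_le(1)[of g] assms(5) by simp
    qed
  next
    case P
    have v: "hub_cap (rot2 g) = 0" using A P hub_cap_0 by auto
    have "hub_cap (rot3 g) + hub_cap (rot4 g) \<le> 29"
    proof (cases "client (rot3 g)")
      case True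
      then have m: "\<not> client_right (rot3 g)" using A P by auto
      have "client_left (rot3 g) \<longrightarrow> \<not> client (rot4 g)"
        using client_ring_imp[of "rot3 g"] client_ring_imp[of "rot4 g"] by (simp; argo)
      then show ?thesis
        using m hub_cap_le[of "rot3 g"] hub_cap_le(1)[of "rot4 g"] hub_cap_0[of "rot4 g"]
        by (cases "client_left (rot3 g)"; auto simp: of_bool_def split: if_splits)
    next
      case False
      then show ?thesis using hub_cap_0[of "rot3 g"] hub_cap_le(1)[of "rot4 g"]
        by (auto simp: of_bool_def split: if_splits)
    qed
    then show ?thesis using S V v serve_cap_le(3)[of g] P assms(5) by simp
  next
    case M
    have v: "hub_cap (rot4 g) = 0" using A M hub_cap_0 by auto
    have "hub_cap (rot2 g) + hub_cap (rot3 g) \<le> 29"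
    proof (cases "client (rot3 g)")
      case True
      then have m: "\<not> client_left (rot3 g)" using A M by auto
      have "client_right (rot3 g) \<longrightarrow> \<not> client (rot2 g)"
        using client_ring_imp[of "rot3 g"] client_ring_imp[of "rot2 g"] by (simp; argo)
      then show ?thesis
        using m hub_cap_le[of "rot3 g"] hub_cap_le(1)[of "rot2 g"] hub_cap_0[of "rot2 g"]
        by (cases "client_right (rot3 g)"; auto simp: of_bool_def split: if_splits)
    next
      case False
      then show ?thesis using hub_cap_0[of "rot3 g"] hub_cap_le(1)[of "rot2 g"]
        by (auto simp: of_bool_def split: if_splits)
    qed
    then show ?thesis using S V v serve_cap_le(3)[of g] M assms(5) by simp
  qed
qed

text \<open>Six rear clients cost exactly 60. A direction costs 19 only next to a direction with an
  empty cell straight ahead, which costs nothing. The only patterns above 60 have one such gap, or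
  two opposite ones, flanked on both sides by clients, and these are excluded below.\<close>

lemma cyc_hub_cap_le_60:
  assumes "locating g" "g (0, 0)" "isolated g" "0 < charge g"
  shows "cyc hub_cap g \<le> 60"
proof -
  have np: "\<not> some_rot uncharged_at g" using charge_0_iff[OF assms(1,2)] assms(4) by auto
  have c0: "client_rear g \<longrightarrow> g (2, 0) \<and> g (0, 2) \<and> g (2, -2)"
    "client_left g \<longrightarrow> g (2, 0) \<and> \<not> g (0, 2) \<and> g (2, -2)"
    "client_right g \<longrightarrow> g (2, 0) \<and> g (0, 2) \<and> \<not> g (2, -2)"
    using client_cells[of "g"] by auto
  have c1: "client_rear (rot g) \<longrightarrow> g (0, 2) \<and> g (-2, 2) \<and> g (2, 0)"
    "client_left (rot g) \<longrightarrow> g (0, 2) \<and> \<not> g (-2, 2) \<and> g (2, 0)"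
    "client_right (rot g) \<longrightarrow> g (0, 2) \<and> g (-2, 2) \<and> \<not> g (2, 0)"
    using client_cells[of "rot g"] by auto
  have c2: "client_rear (rot2 g) \<longrightarrow> g (-2, 2) \<and> g (-2, 0) \<and> g (0, 2)"
    "client_left (rot2 g) \<longrightarrow> g (-2, 2) \<and> \<not> g (-2, 0) \<and> g (0, 2)"
    "client_right (rot2 g) \<longrightarrow> g (-2, 2) \<and> g (-2, 0) \<and> \<not> g (0, 2)"
    using client_cells[of "rot2 g"] by auto
  have c3: "client_rear (rot3 g) \<longrightarrow> g (-2, 0) \<and> g (0, -2) \<and> g (-2, 2)"
    "client_left (rot3 g) \<longrightarrow> g (-2, 0) \<and> \<not> g (0, -2) \<and> g (-2, 2)"
    "client_right (rot3 g) \<longrightarrow> g (-2, 0) \<and> g (0, -2) \<and> \<not> g (-2, 2)"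
    using client_cells[of "rot3 g"] by auto
  have c4: "client_rear (rot4 g) \<longrightarrow> g (0, -2) \<and> g (2, -2) \<and> g (-2, 0)"
    "client_left (rot4 g) \<longrightarrow> g (0, -2) \<and> \<not> g (2, -2) \<and> g (-2, 0)"
    "client_right (rot4 g) \<longrightarrow> g (0, -2) \<and> g (2, -2) \<and> \<not> g (-2, 0)"
    using client_cells[of "rot4 g"] by auto
  have c5: "client_rear (rot5 g) \<longrightarrow> g (2, -2) \<and> g (2, 0) \<and> g (0, -2)"
    "client_left (rot5 g) \<longrightarrow> g (2, -2) \<and> \<not> g (2, 0) \<and> g (0, -2)"
    "client_right (rot5 g) \<longrightarrow> g (2, -2) \<and> g (2, 0) \<and> \<not> g (0, -2)"
    using client_cells[of "rot5 g"] by auto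
  note imp = client_ring_imp[of "g"] client_ring_imp[of "rot g"] client_ring_imp[of "rot2 g"]
      client_ring_imp[of "rot3 g"] client_ring_imp[of "rot4 g"] client_ring_imp[of "rot5 g"]
  \<comment> \<open>This pattern would cost 19 + 19 + 30 = 68, but then the clients determine all
    cells around the origin and make it uncharged.\<close>
  have f0: "\<not> (client_left g \<and> client_right (rot2 g) \<and> client_rear (rot3 g)
      \<and> client_rear (rot4 g) \<and> client_rear (rot5 g))"
    using client_cells[of "g"] client_cells[of "rot2 g"] client_cells[of "rot3 g"]
        client_cells[of "rot4 g"] client_cells[of "rot5 g"] np assms(2,3)
    unfolding some_rot_def uncharged_at_def isolated_def by (simp; argo)
  have f1: "\<not> (client_left (rot g) \<and> client_right (rot3 g) \<and> client_rear (rot4 g)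
      \<and> client_rear (rot5 g) \<and> client_rear g)"
    using client_cells[of "g"] client_cells[of "rot g"] client_cells[of "rot3 g"]
        client_cells[of "rot4 g"] client_cells[of "rot5 g"] np assms(2,3)
    unfolding some_rot_def uncharged_at_def isolated_def by (simp; argo)
  have f2: "\<not> (client_left (rot2 g) \<and> client_right (rot4 g) \<and> client_rear (rot5 g)
      \<and> client_rear g \<and> client_rear (rot g))"
    using client_cells[of "g"] client_cells[of "rot g"] client_cells[of "rot2 g"]
        client_cells[of "rot4 g"] client_cells[of "rot5 g"] np assms(2,3)
    unfolding some_rot_def uncharged_at_def isolated_def by (simp; argo)
  have f3: "\<not> (client_left (rot3 g) \<and> client_right (rot5 g) \<and> client_rear g
      \<and> client_rear (rot g) \<and> client_rear (rot2 g))"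
    using client_cells[of "g"] client_cells[of "rot g"] client_cells[of "rot2 g"]
        client_cells[of "rot3 g"] client_cells[of "rot5 g"] np assms(2,3)
    unfolding some_rot_def uncharged_at_def isolated_def by (simp; argo)
  have f4: "\<not> (client_left (rot4 g) \<and> client_right g \<and> client_rear (rot g)
      \<and> client_rear (rot2 g) \<and> client_rear (rot3 g))"
    using client_cells[of "g"] client_cells[of "rot g"] client_cells[of "rot2 g"]
        client_cells[of "rot3 g"] client_cells[of "rot4 g"] np assms(2,3)
    unfolding some_rot_def uncharged_at_def isolated_def by (simp; argo)
  have f5: "\<not> (client_left (rot5 g) \<and> client_right (rot g) \<and> client_rear (rot2 g)
      \<and> client_rear (rot3 g) \<and> client_rear (rot4 g))"
    using client_cells[of "rot g"] client_cells[of "rot2 g"] client_cells[of "rot3 g"]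
        client_cells[of "rot4 g"] client_cells[of "rot5 g"] np assms(2,3)
    unfolding some_rot_def uncharged_at_def isolated_def by (simp; argo)
  \<comment> \<open>This pattern would cost 4 * 19 = 76, but then two opposite neighbours of the
    origin are both private. A half turn preserves it, so three instances suffice.\<close>
  have h0: "\<not> (client_left g \<and> client_right (rot2 g) \<and> client_left (rot3 g)
      \<and> client_right (rot5 g))"
    using client_cells[of "g"] client_cells[of "rot2 g"] client_cells[of "rot3 g"]
        client_cells[of "rot5 g"] assms(2,3) locating_ring(3)[of "rot g"] locating_rot[OF assms(1)]
        unfolding isolated_def by (simp; argo)
  have h1: "\<not> (client_left (rot g) \<and> client_right (rot3 g) \<and> client_left (rot4 g)
      \<and> client_right g)"
    using client_cells[of "g"] client_cells[of "rot g"] client_cells[of "rot3 g"]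
        client_cells[of "rot4 g"] assms(2,3) locating_ring(3)[of "rot2 g"]
        locating_rot[OF locating_rot[OF assms(1)]] unfolding isolated_def by (simp; argo)
  have h2: "\<not> (client_left (rot2 g) \<and> client_right (rot4 g) \<and> client_left (rot5 g)
      \<and> client_right (rot g))"
    using client_cells[of "rot g"] client_cells[of "rot2 g"] client_cells[of "rot4 g"]
        client_cells[of "rot5 g"] assms(2,3) locating_ring(3)[of "rot3 g"]
        locating_rot[OF locating_rot[OF locating_rot[OF assms(1)]]] unfolding isolated_def by (simp; argo)
  have "cyc hub_cap g = (10 * of_bool (client_rear g) + 19 * of_bool (client_left g) + 19 * of_bool
      (client_right g)) + (10 * of_bool (client_rear (rot g)) + 19 * of_bool (client_left (rot g)) + 19
      * of_bool (client_right (rot g))) + (10 * of_bool (client_rear (rot2 g)) + 19 * of_bool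
      (client_left (rot2 g)) + 19 * of_bool (client_right (rot2 g))) + (10 * of_bool (client_rear (rot3
      g)) + 19 * of_bool (client_left (rot3 g)) + 19 * of_bool (client_right (rot3 g))) + (10 * of_bool
      (client_rear (rot4 g)) + 19 * of_bool (client_left (rot4 g)) + 19 * of_bool (client_right (rot4
      g))) + (10 * of_bool (client_rear (rot5 g)) + 19 * of_bool (client_left (rot5 g)) + 19 * of_bool
      (client_right (rot5 g)))"
    by (simp add: cyc_def hub_cap_def)
  also have "\<dots> \<le> 60"
    by (rule hub_arith[OF c0 c1 c2 c3 c4 c5 f0 f1 f2 f3 f4 f5 h0 h1 h2])
  finally show ?thesis .
qed

lemma some_rotE:
  assumes "some_rot Q g"
  obtains f where "f \<in> orbit g" "Q f"
  using assms unfolding some_rot_def by blast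

lemma orbit_invariant:
  assumes "f \<in> orbit g"
  shows "locating g \<Longrightarrow> locating f" "f (0, 0) = g (0, 0)" "isolated f = isolated g"
      "charge f = charge g" "cyc F f = cyc F g" "code_degree f = code_degree g"
  using assms by (auto simp: locating_rot isolated_rot cyc_rot code_degree_rot)

lemma capacity_isolated:
  assumes "locating g" "g (0, 0)" "isolated g" "78 \<le> charge g"
  shows "cyc hub_cap g + cyc serve_cap g \<le> charge g - 18"
proof (cases "some_rot serving g")
  case True
  then obtain f where f: "f \<in> orbit g" "serving f"
    by (rule some_rotE)
  note o = orbit_invariant[OF f(1)]
  show ?thesis using capacity_isolated_serving[of f] o f assms by simp
next
  case False
  then have "cyc serve_cap g = 0" using serve_cap_le(2) by (simp add: some_rot_def cyc_def)
  then show ?thesis using cyc_hub_cap_le_60[OF assms(1-3)] assms(4) by simp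
qed

section \<open>Capacity of codewords with code neighbours\<close>

lemma aide_one_side:
  assumes "locating g" "g (0, 0)"
  shows "\<not> (aide_right g \<and> aide_left g)"
  \<comment> \<open>Otherwise \<open>(1, -1)\<close> and \<open>(0, 1)\<close> would both see
    exactly the origin and \<open>(1, 0)\<close>.\<close>
  using aide_cells_imp[of g] assms(2) locating_ring(2)[of "rot5 g"] locating_rot[OF locating_rot[OF
      locating_rot[OF locating_rot[OF locating_rot[OF assms(1)]]]]] by (simp; argo)

lemma aide_le_code_degree:
  assumes "locating g" "g (0, 0)"
  shows "cyc (\<lambda>g. 28 * of_bool (aide_right g) + 28 * of_bool (aide_left g)) g \<le> 28 *
      code_degree g"
proof -
  have *: "28 * of_bool (aide_right f) + 28 * of_bool (aide_left f) \<le> (28 :: int) * of_bool (f (1,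
      0))" if "locating f" "f (0, 0)" for f
    using aide_one_side[OF that] aide_cells_imp[of f] by auto
  have "cyc (\<lambda>g. 28 * of_bool (aide_right g) + 28 * of_bool (aide_left g)) g \<le> cyc
      (\<lambda>f. 28 * of_bool (f (1, 0))) g"
    unfolding cyc_def using assms by (intro add_mono *) (simp_all add: locating_rot)
  also have "\<dots> = 28 * code_degree g" by (simp add: cyc_def code_degree_def)
  finally show ?thesis .
qed

lemma serving_excludes_front:
  assumes "serving g"
  shows "\<not> client g" "\<not> client (rot g)" "\<not> client (rot5 g)" "\<not> serving (rot g)"
      "\<not> serving (rot5 g)"
  using assms hole_cells_imp[of "g"] hole_cells_imp[of "rot g"] hole_cells_imp[of "rot5 g"]
      client_ring_imp[of "g"] client_ring_imp[of "rot g"] client_ring_imp[of "rot5 g"]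
  unfolding serving_def by (simp; argo)+

lemma nonisolated_serving_both:
  assumes "locating g" "g (0, 0)" "\<not> isolated g" "hole_mid g" "hole_left g" "hole_right g"
  shows "\<not> client (rot2 g)" "\<not> client (rot3 g)" "\<not> client (rot4 g)"
      "\<not> serving (rot2 g)" "\<not> serving (rot3 g)" "\<not> serving (rot4 g)"
  using assms(2-) hole_cells_imp[of "g"] hole_cells_imp[of "rot g"] hole_cells_imp[of "rot2 g"]
      hole_cells_imp[of "rot3 g"] hole_cells_imp[of "rot4 g"] hole_cells_imp[of "rot5 g"]
      client_ring_imp[of "rot2 g"] client_ring_imp[of "rot3 g"] client_ring_imp[of "rot4 g"]
      locating_ring(1)[of "rot4 g"] locating_rot[OF locating_rot[OF locating_rot[OF locating_rot[OF
      assms(1)]]]] locating_ring(1)[of "rot g"] locating_rot[OF assms(1)]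
  unfolding serving_def isolated_def by (simp; argo)+

lemma nonisolated_serving_left:
  assumes "locating g" "g (0, 0)" "\<not> isolated g" "hole_mid g" "hole_left g"
  shows "\<not> client (rot2 g)" "\<not> serving (rot2 g)" "\<not> (serving (rot3 g)
      \<and> serving (rot4 g))" "serving (rot3 g) \<or> serving (rot4 g)
      \<longrightarrow> \<not> client (rot3 g) \<and> \<not> client (rot4 g)"
    "\<not> (hole_mid (rot4 g) \<and> hole_left (rot4 g) \<and> hole_right (rot4 g))"
        "\<not> (client (rot3 g) \<and> client (rot4 g))" "\<not> (hole_mid (rot3 g)
        \<and> hole_left (rot3 g) \<and> hole_right (rot3 g))"
  using assms(2-) hole_cells_imp[of "g"] hole_cells_imp[of "rot g"] hole_cells_imp[of "rot2 g"]
      hole_cells_imp[of "rot3 g"] hole_cells_imp[of "rot4 g"] hole_cells_imp[of "rot5 g"]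
      client_ring_imp[of "rot2 g"] client_ring_imp[of "rot3 g"] client_ring_imp[of "rot4 g"]
      locating_ring(1)[of "rot4 g"] locating_rot[OF locating_rot[OF locating_rot[OF locating_rot[OF
      assms(1)]]]] locating_ring(1)[of "rot g"] locating_rot[OF assms(1)]
  unfolding serving_def isolated_def by (simp; argo)+

lemma nonisolated_serving_right:
  assumes "locating g" "g (0, 0)" "\<not> isolated g" "hole_mid g" "hole_right g"
  shows "\<not> client (rot4 g)" "\<not> serving (rot4 g)" "\<not> (serving (rot3 g)
      \<and> serving (rot2 g))" "serving (rot3 g) \<or> serving (rot2 g)
      \<longrightarrow> \<not> client (rot3 g) \<and> \<not> client (rot2 g)"
    "\<not> (hole_mid (rot2 g) \<and> hole_left (rot2 g) \<and> hole_right (rot2 g))"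
        "\<not> (client (rot3 g) \<and> client (rot2 g))" "\<not> (hole_mid (rot3 g)
        \<and> hole_left (rot3 g) \<and> hole_right (rot3 g))"
  using assms(2-) hole_cells_imp[of "g"] hole_cells_imp[of "rot g"] hole_cells_imp[of "rot2 g"]
      hole_cells_imp[of "rot3 g"] hole_cells_imp[of "rot4 g"] hole_cells_imp[of "rot5 g"]
      client_ring_imp[of "rot2 g"] client_ring_imp[of "rot3 g"] client_ring_imp[of "rot4 g"]
      locating_ring(1)[of "rot4 g"] locating_rot[OF locating_rot[OF locating_rot[OF locating_rot[OF
      assms(1)]]]] locating_ring(1)[of "rot g"] locating_rot[OF assms(1)]
  unfolding serving_def isolated_def by (simp; argo)+

lemma hub_cap_bounds: "hub_cap g \<le> 19" "0 \<le> hub_cap g"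
  using hub_cap_le(1)[of g] by (auto simp: of_bool_def hub_cap_def split: if_splits)

text \<open>Three recipients around one hole cost 56 and exclude all other payments. A pair costs
  28, and the directions behind it add at most another pair or a single client.\<close>

lemma nonisolated_serving_le_60:
  assumes "locating g" "g (0, 0)" "\<not> isolated g" "serving g"
  shows "cyc hub_cap g + cyc serve_cap g \<le> 60"
proof -
  note C = serving_excludes_front[OF assms(4)]
  have v: "hub_cap g = 0" "hub_cap (rot g) = 0" "hub_cap (rot5 g) = 0" "serve_cap (rot g) = 0"
      "serve_cap (rot5 g) = 0"
    using C hub_cap_0 serve_cap_le(2) by auto
  consider (both) "hole_mid g" "hole_left g" "hole_right g" | (P) "hole_mid g" "hole_left g"
      "\<not> hole_right g" | (M) "hole_mid g" "hole_right g" "\<not> hole_left g"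
    using assms(4) by (auto simp: serving_def)
  then show ?thesis
  proof cases
    case both
    have "hub_cap (rot2 g) = 0" "hub_cap (rot3 g) = 0" "hub_cap (rot4 g) = 0" "serve_cap (rot2 g) = 0"
        "serve_cap (rot3 g) = 0" "serve_cap (rot4 g) = 0"
      using nonisolated_serving_both[OF assms(1-3) both] hub_cap_0 serve_cap_le(2) by auto
    then show ?thesis using v serve_cap_le(1)[of g] by (simp add: cyc_def)
  next
    case P
    note N = nonisolated_serving_left[OF assms(1-3) P(1,2)]
    have w: "hub_cap (rot2 g) = 0" "serve_cap (rot2 g) = 0" "serve_cap g \<le> 28"
        "serve_cap (rot4 g) \<le> 28" "serve_cap (rot3 g) \<le> 28"
      using N hub_cap_0 serve_cap_le(2,3) P by auto
    consider "serving (rot3 g)" | "serving (rot4 g)" | "\<not> serving (rot3 g)"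
        "\<not> serving (rot4 g)" by blast
    then have "hub_cap (rot3 g) + hub_cap (rot4 g) + serve_cap (rot3 g) + serve_cap (rot4 g) \<le> 28"
    proof cases
      case 1
      then have "hub_cap (rot3 g) = 0" "hub_cap (rot4 g) = 0" "serve_cap (rot4 g) = 0"
        using N hub_cap_0 serve_cap_le(2) by auto
      then show ?thesis using w by simp
    next
      case 2
      then have "hub_cap (rot3 g) = 0" "hub_cap (rot4 g) = 0" "serve_cap (rot3 g) = 0"
        using N hub_cap_0 serve_cap_le(2) by auto
      then show ?thesis using w by simp
    next
      case 3
      then have "serve_cap (rot3 g) = 0" "serve_cap (rot4 g) = 0" "hub_cap (rot3 g) = 0
          \<or> hub_cap (rot4 g) = 0" using N hub_cap_0 serve_cap_le(2) by auto
      then show ?thesis using hub_cap_bounds[of "rot3 g"] hub_cap_bounds[of "rot4 g"] by linarith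
    qed
    then show ?thesis using v w by (simp add: cyc_def)
  next
    case M
    note N = nonisolated_serving_right[OF assms(1-3) M(1,2)]
    have w: "hub_cap (rot4 g) = 0" "serve_cap (rot4 g) = 0" "serve_cap g \<le> 28"
        "serve_cap (rot2 g) \<le> 28" "serve_cap (rot3 g) \<le> 28"
      using N hub_cap_0 serve_cap_le(2,3) M by auto
    consider "serving (rot3 g)" | "serving (rot2 g)" | "\<not> serving (rot3 g)"
        "\<not> serving (rot2 g)" by blast
    then have "hub_cap (rot3 g) + hub_cap (rot2 g) + serve_cap (rot3 g) + serve_cap (rot2 g) \<le> 28"
    proof cases
      case 1
      then have "hub_cap (rot3 g) = 0" "hub_cap (rot2 g) = 0" "serve_cap (rot2 g) = 0"
        using N hub_cap_0 serve_cap_le(2) by auto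
      then show ?thesis using w by simp
    next
      case 2
      then have "hub_cap (rot3 g) = 0" "hub_cap (rot2 g) = 0" "serve_cap (rot3 g) = 0"
        using N hub_cap_0 serve_cap_le(2) by auto
      then show ?thesis using w by simp
    next
      case 3
      then have "serve_cap (rot3 g) = 0" "serve_cap (rot2 g) = 0" "hub_cap (rot3 g) = 0
          \<or> hub_cap (rot2 g) = 0" using N hub_cap_0 serve_cap_le(2) by auto
      then show ?thesis using hub_cap_bounds[of "rot3 g"] hub_cap_bounds[of "rot2 g"] by linarith
    qed
    then show ?thesis using v w by (simp add: cyc_def)
  qed
qed

lemma nonisolated_le_60:
  assumes "locating g" "g (0, 0)" "\<not> isolated g"
  shows "cyc hub_cap g + cyc serve_cap g \<le> 60"
proof (cases "some_rot serving g")
  case True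
  then obtain f where f: "f \<in> orbit g" "serving f"
    by (rule some_rotE)
  note o = orbit_invariant[OF f(1)]
  show ?thesis using nonisolated_serving_le_60[of f] o f assms by simp
next
  case False
  then have s: "cyc serve_cap g = 0" using serve_cap_le(2) by (simp add: some_rot_def cyc_def)
  have "some_rot (\<lambda>g. g (1, 0)) g" using assms(3) by (auto simp: some_rot_def isolated_def)
  then obtain f where f: "f \<in> orbit g" "f (1, 0)"
    by (rule some_rotE)
  \<comment> \<open>A code neighbour excludes clients in its own direction and the two next to it;
    the other three directions cost at most 3 * 19 = 57.\<close>
  have "\<not> client f" "\<not> client (rot f)" "\<not> client (rot5 f)"
    using f(2) client_ring_imp[of f] client_ring_imp[of "rot f"] client_ring_imp[of "rot5 f"] by auto
  then have "cyc hub_cap f \<le> 57"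
    using hub_cap_0 hub_cap_bounds(1)[of "rot2 f"] hub_cap_bounds(1)[of "rot3 f"]
        hub_cap_bounds(1)[of "rot4 f"] by (simp add: cyc_def)
  then show ?thesis using s orbit_invariant(5)[OF f(1), of hub_cap] by simp
qed

lemma single_nbr_aide_right:
  assumes "locating g" "g (0, 0)" "code_degree g = 1" "aide_right g"
  shows "\<not> client g" "\<not> client (rot g)" "\<not> client (rot4 g)" "\<not> client (rot5 g)"
      "\<not> serving g" "\<not> serving (rot3 g)" "\<not> serving (rot4 g)" "\<not> serving (rot5 g)"
    "\<not> (serving (rot g) \<and> serving (rot2 g))" "serving (rot g) \<or> serving (rot2 g)
        \<longrightarrow> \<not> client (rot2 g) \<and> \<not> client (rot3 g)"
    "\<not> (hole_mid (rot g) \<and> hole_left (rot g) \<and> hole_right (rot g))"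
        "\<not> (hole_mid (rot2 g) \<and> hole_left (rot2 g) \<and> hole_right (rot2 g))"
    "\<not> client_left (rot3 g)" "client_right (rot3 g) \<longrightarrow> \<not> client (rot2 g)"
proof -
  have "g (1, 0)" using aide_cells_imp[of g] assms(4) by blast
  then have E: "\<not> g (0, 1) \<and> \<not> g (-1, 1) \<and> \<not> g (-1, 0) \<and> \<not> g (0, -1)
      \<and> \<not> g (1, -1)"
    using assms(3) by (auto simp: code_degree_def of_bool_def split: if_splits)
  show "\<not> client g" "\<not> client (rot g)" "\<not> client (rot4 g)" "\<not> client (rot5 g)"
      "\<not> serving g" "\<not> serving (rot3 g)" "\<not> serving (rot4 g)" "\<not> serving (rot5 g)"
    "\<not> (serving (rot g) \<and> serving (rot2 g))" "serving (rot g) \<or> serving (rot2 g)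
        \<longrightarrow> \<not> client (rot2 g) \<and> \<not> client (rot3 g)"
    "\<not> (hole_mid (rot g) \<and> hole_left (rot g) \<and> hole_right (rot g))"
        "\<not> (hole_mid (rot2 g) \<and> hole_left (rot2 g) \<and> hole_right (rot2 g))"
    "\<not> client_left (rot3 g)" "client_right (rot3 g) \<longrightarrow> \<not> client (rot2 g)"
    using E assms(2,4) aide_cells_imp[of g] hole_cells_imp[of "g"] hole_cells_imp[of "rot g"]
        hole_cells_imp[of "rot2 g"] hole_cells_imp[of "rot3 g"] hole_cells_imp[of "rot4 g"]
        hole_cells_imp[of "rot5 g"] client_ring_imp[of "g"] client_ring_imp[of "rot g"]
        client_ring_imp[of "rot2 g"] client_ring_imp[of "rot3 g"] client_ring_imp[of "rot4 g"]
        client_ring_imp[of "rot5 g"]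
    unfolding serving_def by (simp; argo)+
qed

lemma single_nbr_aide_left:
  assumes "locating g" "g (0, 0)" "code_degree g = 1" "aide_left g"
  shows "\<not> client g" "\<not> client (rot g)" "\<not> client (rot2 g)" "\<not> client (rot5 g)"
      "\<not> serving g" "\<not> serving (rot3 g)" "\<not> serving (rot2 g)" "\<not> serving (rot g)"
    "\<not> (serving (rot5 g) \<and> serving (rot4 g))" "serving (rot5 g) \<or> serving (rot4 g)
        \<longrightarrow> \<not> client (rot4 g) \<and> \<not> client (rot3 g)"
    "\<not> (hole_mid (rot5 g) \<and> hole_left (rot5 g) \<and> hole_right (rot5 g))"
        "\<not> (hole_mid (rot4 g) \<and> hole_left (rot4 g) \<and> hole_right (rot4 g))"
    "\<not> client_right (rot3 g)" "client_left (rot3 g) \<longrightarrow> \<not> client (rot4 g)"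
proof -
  have "g (1, 0)" using aide_cells_imp[of g] assms(4) by blast
  then have E: "\<not> g (0, 1) \<and> \<not> g (-1, 1) \<and> \<not> g (-1, 0) \<and> \<not> g (0, -1)
      \<and> \<not> g (1, -1)"
    using assms(3) by (auto simp: code_degree_def of_bool_def split: if_splits)
  show "\<not> client g" "\<not> client (rot g)" "\<not> client (rot2 g)" "\<not> client (rot5 g)"
      "\<not> serving g" "\<not> serving (rot3 g)" "\<not> serving (rot2 g)" "\<not> serving (rot g)"
    "\<not> (serving (rot5 g) \<and> serving (rot4 g))" "serving (rot5 g) \<or> serving (rot4 g)
        \<longrightarrow> \<not> client (rot4 g) \<and> \<not> client (rot3 g)"
    "\<not> (hole_mid (rot5 g) \<and> hole_left (rot5 g) \<and> hole_right (rot5 g))"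
        "\<not> (hole_mid (rot4 g) \<and> hole_left (rot4 g) \<and> hole_right (rot4 g))"
    "\<not> client_right (rot3 g)" "client_left (rot3 g) \<longrightarrow> \<not> client (rot4 g)"
    using E assms(2,4) aide_cells_imp[of g] hole_cells_imp[of "g"] hole_cells_imp[of "rot g"]
        hole_cells_imp[of "rot2 g"] hole_cells_imp[of "rot3 g"] hole_cells_imp[of "rot4 g"]
        hole_cells_imp[of "rot5 g"] client_ring_imp[of "g"] client_ring_imp[of "rot g"]
        client_ring_imp[of "rot2 g"] client_ring_imp[of "rot3 g"] client_ring_imp[of "rot4 g"]
        client_ring_imp[of "rot5 g"]
    unfolding serving_def by (simp; argo)+
qed

text \<open>The charge 78 of a codeword with one code neighbour, less 28 for an aided pair and 18 to
  keep, leaves 32.\<close>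

lemma single_nbr_aide_le_32:
  assumes "locating g" "g (0, 0)" "code_degree g = 1" "aide_right g \<or> aide_left g"
  shows "cyc hub_cap g + cyc serve_cap g \<le> 32"
  using assms(4)
proof
  assume "aide_right g"
  note C = single_nbr_aide_right[OF assms(1-3) this]
  have z: "hub_cap g = 0" "hub_cap (rot g) = 0" "hub_cap (rot4 g) = 0" "hub_cap (rot5 g) = 0"
      "serve_cap g = 0" "serve_cap (rot3 g) = 0" "serve_cap (rot4 g) = 0" "serve_cap (rot5 g) = 0"
    using C hub_cap_0 serve_cap_le(2) by auto
  have w: "serve_cap (rot g) \<le> 28" "serve_cap (rot2 g) \<le> 28" "serve_cap (rot g) = 0
      \<or> serve_cap (rot2 g) = 0" using C serve_cap_le(2,3) by auto
  have "hub_cap (rot2 g) + hub_cap (rot3 g) \<le> 29"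
    using C(13,14) hub_cap_bounds[of "rot2 g"] hub_cap_bounds[of "rot3 g"] hub_cap_le(2)[of "rot3 g"]
        hub_cap_0[of "rot2 g"] by (cases "client_right (rot3 g)") auto
  moreover have "serving (rot g) \<or> serving (rot2 g) \<Longrightarrow> hub_cap (rot2 g) = 0
      \<and> hub_cap (rot3 g) = 0" using C hub_cap_0 by auto
  moreover have "\<not> (serving (rot g) \<or> serving (rot2 g)) \<Longrightarrow> serve_cap (rot g) = 0
      \<and> serve_cap (rot2 g) = 0" using serve_cap_le(2) by auto
  ultimately show ?thesis
    using z w by (cases "serving (rot g) \<or> serving (rot2 g)") (auto simp: cyc_def)
next
  assume "aide_left g"
  note C = single_nbr_aide_left[OF assms(1-3) this]
  have z: "hub_cap g = 0" "hub_cap (rot g) = 0" "hub_cap (rot2 g) = 0" "hub_cap (rot5 g) = 0"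
      "serve_cap g = 0" "serve_cap (rot3 g) = 0" "serve_cap (rot2 g) = 0" "serve_cap (rot g) = 0"
    using C hub_cap_0 serve_cap_le(2) by auto
  have w: "serve_cap (rot5 g) \<le> 28" "serve_cap (rot4 g) \<le> 28" "serve_cap (rot5 g) = 0
      \<or> serve_cap (rot4 g) = 0" using C serve_cap_le(2,3) by auto
  have "hub_cap (rot4 g) + hub_cap (rot3 g) \<le> 29"
    using C(13,14) hub_cap_bounds[of "rot4 g"] hub_cap_bounds[of "rot3 g"] hub_cap_le(2)[of "rot3 g"]
        hub_cap_0[of "rot4 g"] by (cases "client_left (rot3 g)") auto
  moreover have "serving (rot5 g) \<or> serving (rot4 g) \<Longrightarrow> hub_cap (rot4 g) = 0
      \<and> hub_cap (rot3 g) = 0" using C hub_cap_0 by auto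
  moreover have "\<not> (serving (rot5 g) \<or> serving (rot4 g)) \<Longrightarrow> serve_cap (rot5 g)
      = 0 \<and> serve_cap (rot4 g) = 0" using serve_cap_le(2) by auto
  ultimately show ?thesis
    using z w by (cases "serving (rot5 g) \<or> serving (rot4 g)") (auto simp: cyc_def)
qed

definition aide_cap :: "config \<Rightarrow> int" where
  "aide_cap g = 28 * of_bool (aide_right g) + 28 * of_bool (aide_left g)"

text \<open>Each code neighbour brings 78 and causes at most 28 of aid. From two neighbours on, this
  covers the remaining 60 + 18 with room to spare; with one neighbour and an aided pair the sharper
  bound 32 is needed.\<close>

lemma capacity_nonisolated:
  assumes "locating g" "g (0, 0)" "\<not> isolated g"
  shows "cyc hub_cap g + cyc serve_cap g + cyc aide_cap g \<le> charge g - 18"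
proof -
  have c: "cyc aide_cap g \<le> 28 * code_degree g" using aide_le_code_degree[OF assms(1,2)]
    by (simp add: aide_cap_def[abs_def])
  have n: "1 \<le> code_degree g" using assms(3) by (auto simp: isolated_def code_degree_def)
  have h: "charge g = 78 * code_degree g" using assms by (simp add: charge_def)
  note l = nonisolated_le_60[OF assms]
  consider "2 \<le> code_degree g" | "code_degree g = 1" "some_rot (\<lambda>g. aide_right g
      \<or> aide_left g) g" | "code_degree g = 1" "\<not> some_rot (\<lambda>g. aide_right g
      \<or> aide_left g) g"
    using n by linarith
  then show ?thesis
  proof cases
    case 1
    then show ?thesis using c h l by linarith
  next
    case 2
    obtain f where f: "f \<in> orbit g" "aide_right f \<or> aide_left f"
      using 2(2) by (rule some_rotE)
    note o = orbit_invariant[OF f(1)]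
    have "cyc hub_cap g + cyc serve_cap g \<le> 32" using single_nbr_aide_le_32[of f] o f 2(1) assms by simp
    then show ?thesis using c h 2 by linarith
  next
    case 3
    then have "cyc aide_cap g = 0" by (simp add: some_rot_def cyc_def aide_cap_def)
    then show ?thesis using h l 3 by linarith
  qed
qed

section \<open>Balance at a single vertex\<close>

definition paid :: "config \<Rightarrow> int" where
  "paid g = hub_paid g + serve_paid g + aide_paid g"

lemma cyc_mono_orbit:
  assumes "\<And>f. f \<in> orbit g \<Longrightarrow> F f \<le> G f"
  shows "cyc F g \<le> cyc G g"
  unfolding cyc_def by (intro add_mono assms) simp_all

lemma paid_low:
  assumes "charge g < 78" "locating g"
  shows "paid g \<le> (if 0 < charge g then 4 * of_bool (client_left g) + 4 * of_bool (client_right g)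
      else 0)"
proof -
  have "serve_paid g = 0"
    using assms by (simp add: serve_paid_def far_server_def mid_pay_def own_server_def partner_left_def
        partner_right_def shift_rot shift_shift)
  moreover have "rear (-2) 2 (rot (shift 2 0 g)) = 0" "rear (-2) 0 (shift 2 0 g) = 0"
      "rear 0 (-2) (rot5 (shift 2 0 g)) = 0"
    "far (-4) 2 (-2) (-2) (rot (shift 2 2 g)) = 0" "far (-2) (-2) (-4) 2 (rot5 (shift 4 (-2) g)) = 0"
    using assms by (simp_all add: rear_def far_def shift_rot shift_shift)
  moreover have "side_left (rot2 (shift 2 0 g)) \<le> (if 0 < charge g then 4 * of_bool (client_left g)
      else 0)"
    "side_right (rot4 (shift 2 0 g)) \<le> (if 0 < charge g then 4 * of_bool (client_right g) else 0)"
    using assms by (simp_all add: side_left_def side_right_def client_left_def client_right_def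
        shift_rot shift_shift)
  \<comment> \<open>A codeword acting as aide has a code neighbour and thus charge at least
    78.\<close>
  moreover have "aide_paid g = 0"
  proof -
    have n: "g (0, 0) \<Longrightarrow> aide_paid g \<le> 0"
      using charge_lt_78(1)[of g] assms aide_cells_imp[of g] aide_paid_le[OF assms(2)]
      by (auto simp: isolated_def)
    have "\<not> g (0, 0) \<Longrightarrow> aide_paid g = 0"
      by (simp add: aide_paid_def own_aide_left_def partner_aide_left_def own_aide_right_def
          partner_aide_right_def)
    moreover have "0 \<le> aide_paid g"
      by (simp add: aide_paid_def own_aide_left_def partner_aide_left_def own_aide_right_def
          partner_aide_right_def)
    ultimately show ?thesis using n by fastforce
  qed
  ultimately show ?thesis unfolding paid_def hub_paid_def
    by (cases "0 < charge g"; simp only: if_True if_False; linarith)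
qed

text \<open>A single trine yields 26, which leaves 8 after keeping 18. The trine excludes clients in
  three directions. Of the other three, a paid client in the middle direction excludes clients in
  one of the outer ones, and no direction costs more than 4.\<close>

lemma poor_pays_le_8:
  assumes "isolated g" "trine g"
  shows "cyc (\<lambda>g. 4 * of_bool (client_left g) + 4 * of_bool (client_right g)) g \<le> 8"
proof -
  have n: "\<not> client g" "\<not> client (rot g)" "\<not> client (rot5 g)"
    using assms(2) client_ring_imp[of g] client_ring_imp[of "rot g"] client_ring_imp[of "rot5 g"]
        unfolding trine_def by (simp; argo)+
  have m: "\<not> (client_left f \<and> client_right f)" for f using client_cells(2,3)[of f] by blast
  have "client_left (rot2 g) \<longrightarrow> \<not> client (rot3 g)" "client_right (rot3 g)
      \<longrightarrow> \<not> client (rot2 g)" "client_left (rot3 g) \<longrightarrow> \<not> client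
      (rot4 g)"
    using client_ring_imp[of "rot2 g"] client_ring_imp[of "rot3 g"] client_ring_imp[of "rot4 g"]
    by (simp; argo)+
  then show ?thesis
    using n m[of "rot2 g"] m[of "rot3 g"] m[of "rot4 g"] unfolding cyc_def client_def
    by (cases "client_left (rot3 g)"; cases "client_right (rot3 g)"; auto simp: of_bool_def)
qed

lemma received_nonneg: "0 \<le> received g"
  unfolding received_def using rules_nonneg by (intro add_nonneg_nonneg) auto

lemma cyc_add: "cyc (\<lambda>g. F g + G g) g = cyc F g + cyc G g"
  by (simp add: cyc_def)

lemma paid_le:
  assumes "locating g" "g (0, 0)"
  shows "paid g \<le> hub_cap g + serve_cap g + aide_cap g"
  using hub_paid_le[of g] serve_paid_le[OF assms] aide_paid_le[OF assms(1)]
  by (simp add: paid_def hub_cap_def aide_cap_def)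

lemma cyc_paid_le:
  assumes "locating g" "g (0, 0)"
  shows "cyc paid g \<le> cyc hub_cap g + cyc serve_cap g + cyc aide_cap g"
proof -
  have "cyc paid g \<le> cyc (\<lambda>g. hub_cap g + serve_cap g + aide_cap g) g"
    unfolding cyc_def using assms by (intro add_mono paid_le) (simp_all add: locating_rot)
  then show ?thesis by (simp add: cyc_def)
qed

lemma discharge:
  assumes "locating g"
  shows "18 * of_bool (g (0, 0)) \<le> charge g + cyc received g - cyc paid g"
proof (cases "charge g < 78")
  case low: True
  have L: "locating f" if "f \<in> orbit g" for f using orbit_invariant(1)[OF that assms] .
  have e: "charge f = charge g" if "f \<in> orbit g" for f using orbit_invariant(4)[OF that] .
  have c: "charge f < 78" if "f \<in> orbit g" for f using low e[OF that] by simp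
  show ?thesis
  proof (cases "0 < charge g")
    case True
    then have g: "g (0, 0) \<and> isolated g \<and> some_rot private_at g
        \<and> \<not> some_rot irregular g \<and> some_rot trine g" using poor_codeword low by auto
    then have "some_rot trine g" by blast
    then obtain f where f: "f \<in> orbit g" "trine f" by (rule some_rotE)
    have "cyc paid g \<le> cyc (\<lambda>g. 4 * of_bool (client_left g) + 4 * of_bool (client_right g)) g"
    proof (rule cyc_mono_orbit)
      fix f assume f: "f \<in> orbit g"
      show "paid f \<le> 4 * of_bool (client_left f) + 4 * of_bool (client_right f)"
        using paid_low[OF c[OF f] L[OF f]] e[OF f] True by simp
    qed
    also have "\<dots> \<le> 8"
      using poor_pays_le_8[of f] f g orbit_invariant(3)[OF f(1)] orbit_invariant(5)[OF f(1), of
          "\<lambda>g. 4 * of_bool (client_left g) + 4 * of_bool (client_right g)"] by simp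
    finally have "cyc paid g \<le> 8" .
    moreover have "0 \<le> cyc received g" by (intro cyc_nonneg received_nonneg)
    ultimately show ?thesis using charge_pos_26[OF True] by (simp add: of_bool_def)
  next
    case False
    then have z: "charge g = 0" using charge_nonneg[of g] by simp
    have "cyc paid g \<le> cyc (\<lambda>_. 0) g"
    proof (rule cyc_mono_orbit)
      fix f assume f: "f \<in> orbit g"
      show "paid f \<le> 0"
        using paid_low[OF c[OF f] L[OF f]] e[OF f] z by simp
    qed
    then have s: "cyc paid g \<le> 0" by (simp add: cyc_def)
    show ?thesis
    proof (cases "g (0, 0)")
      case True
      then have "some_rot uncharged_at g" using charge_0_iff[OF assms True] z by simp
      then obtain f where f: "f \<in> orbit g" "uncharged_at f" by (rule some_rotE)
      have "18 \<le> received f" using received_ge f orbit_invariant(1)[OF f(1)] assms by simp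
      then have "18 \<le> cyc received f" by (intro cyc_ge received_nonneg) (simp add: some_rot_def)
      then show ?thesis using s z orbit_invariant(5)[OF f(1), of received] by simp
    next
      case False
      moreover have "0 \<le> cyc received g" by (intro cyc_nonneg received_nonneg)
      ultimately show ?thesis using s z by simp
    qed
  qed
next
  case False
  then have g: "g (0, 0)" by (simp add: charge_pos_code)
  have r: "0 \<le> cyc received g" by (intro cyc_nonneg received_nonneg)
  show ?thesis
  proof (cases "isolated g")
    case True
    have "aide_cap f = 0" if "f \<in> orbit g" for f
      using aide_cells_imp[of f] True orbit_invariant(3)[OF that] unfolding aide_cap_def isolated_def by auto
    then have "cyc aide_cap g = 0" by (simp add: cyc_def)
    then show ?thesis using capacity_isolated[OF assms g True] cyc_paid_le[OF assms g] r g False by simp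
  next
    case n: False
    show ?thesis using capacity_nonisolated[OF assms g n] cyc_paid_le[OF assms g] r g by simp
  qed
qed

section \<open>Summation over the circulant graph\<close>

definition view :: "int \<Rightarrow> int \<Rightarrow> int set \<Rightarrow> int \<Rightarrow> config" where
  "view n d C i = (\<lambda>(x, y). (i + x + d * y) mod n \<in> C)"

definition total :: "int \<Rightarrow> int \<Rightarrow> int set \<Rightarrow> (config \<Rightarrow>
    int) \<Rightarrow> int" where
  "total n d C F = (\<Sum>i\<in>{0..<n}. F (view n d C i))"

lemma shift_view: "shift a b (view n d C i) = view n d C (i + a + d * b)"
  by (auto simp: view_def fun_eq_iff algebra_simps)

lemma view_mod: "view n d C (i mod n) = view n d C i"
  by (auto simp: view_def fun_eq_iff mod_add_left_eq add.assoc)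

lemma sum_shift_mod:
  fixes F :: "int \<Rightarrow> int"
  assumes "0 < n"
  shows "(\<Sum>i\<in>{0..<n}. F ((i + c) mod n)) = (\<Sum>i\<in>{0..<n}. F i)"
proof (rule sum.reindex_bij_witness[of _ "\<lambda>i. (i - c) mod n" "\<lambda>i. (i + c) mod n"])
qed (use assms in \<open>auto simp: mod_simps\<close>)

lemma total_shift:
  assumes "0 < n"
  shows "total n d C (\<lambda>g. F (shift a b g)) = total n d C F"
proof -
  have "total n d C (\<lambda>g. F (shift a b g)) = (\<Sum>i\<in>{0..<n}. F (view n d C ((i + (a + d *
      b)) mod n)))"
    by (simp add: total_def shift_view view_mod add.assoc)
  also have "\<dots> = total n d C F"
    unfolding total_def by (rule sum_shift_mod[OF assms])
  finally show ?thesis .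
qed

lemma total_add: "total n d C (\<lambda>g. F g + G g) = total n d C F + total n d C G"
  and total_diff: "total n d C (\<lambda>g. F g - G g) = total n d C F - total n d C G"
  and total_scale: "total n d C (\<lambda>g. c * F g) = c * total n d C F"
  by (simp_all add: total_def sum.distrib sum_subtractf sum_distrib_left)

lemma total_const: "0 < n \<Longrightarrow> total n d C (\<lambda>g. c) = n * c"
  by (simp add: total_def)

lemma cyc_comp_rot: "cyc (\<lambda>g. F (rot g)) g = cyc F g"
  by (simp add: cyc_def rot_6)

lemma total_cyc_shift:
  assumes "0 < n"
  shows "total n d C (cyc (\<lambda>g. F (shift a b g))) = total n d C (cyc F)"
proof -
  have t: "total n d C (\<lambda>g. F (rot (shift a b g))) = total n d C (\<lambda>g. F (rot g))" for F a b
    using total_shift[OF assms, of d C "\<lambda>g. F (rot g)" a b] .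
  have "total n d C (\<lambda>g. F (shift a b g)) = total n d C F"
    "total n d C (\<lambda>g. F (shift a b (rot g))) = total n d C (\<lambda>g. F (rot g))"
    "total n d C (\<lambda>g. F (shift a b (rot2 g))) = total n d C (\<lambda>g. F (rot2 g))"
    "total n d C (\<lambda>g. F (shift a b (rot3 g))) = total n d C (\<lambda>g. F (rot3 g))"
    "total n d C (\<lambda>g. F (shift a b (rot4 g))) = total n d C (\<lambda>g. F (rot4 g))"
    "total n d C (\<lambda>g. F (shift a b (rot5 g))) = total n d C (\<lambda>g. F (rot5 g))"
    unfolding shift_rot
    using total_shift[OF assms, of d C F] t[of F] t[of "\<lambda>g. F (rot g)"] t[of "\<lambda>g. F (rot2 g)"]
      t[of "\<lambda>g. F (rot3 g)"] t[of "\<lambda>g. F (rot4 g)"] by auto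
  then show ?thesis unfolding cyc_def total_add by simp
qed

text \<open>Each summand of \<open>paid\<close> is a rule from \<open>received\<close> composed with
  a shift and a rotation. Neither affects a total over all vertices and all six rotations.\<close>

lemma total_paid_eq_received:
  assumes "0 < n"
  shows "total n d C (cyc paid) = total n d C (cyc received)"
proof -
  note r = total_cyc_shift[OF assms]
  have c: "total n d C (cyc (\<lambda>g. F (shift a b g))) = total n d C (cyc F)"
    "total n d C (cyc (\<lambda>g. F (rot (shift a b g)))) = total n d C (cyc F)"
    "total n d C (cyc (\<lambda>g. F (rot2 (shift a b g)))) = total n d C (cyc F)"
    "total n d C (cyc (\<lambda>g. F (rot3 (shift a b g)))) = total n d C (cyc F)"
    "total n d C (cyc (\<lambda>g. F (rot4 (shift a b g)))) = total n d C (cyc F)"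
    "total n d C (cyc (\<lambda>g. F (rot5 (shift a b g)))) = total n d C (cyc F)" for F a b
    using r[of d C F a b] r[of d C "\<lambda>g. F (rot g)" a b] r[of d C "\<lambda>g. F (rot2 g)" a b]
        r[of d C "\<lambda>g. F (rot3 g)" a b]
      r[of d C "\<lambda>g. F (rot4 g)" a b] r[of d C "\<lambda>g. F (rot5 g)" a b]
      cyc_comp_rot[of F, abs_def] cyc_comp_rot[of "\<lambda>g. F (rot g)", abs_def]
          cyc_comp_rot[of "\<lambda>g. F (rot2 g)", abs_def]
      cyc_comp_rot[of "\<lambda>g. F (rot3 g)", abs_def] cyc_comp_rot[of "\<lambda>g. F (rot4 g)", abs_def]
    by (simp_all only:)
  have a: "cyc (\<lambda>g. F g + G g) = (\<lambda>g. cyc F g + cyc G g)" for F G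
    by (simp add: fun_eq_iff cyc_add)
  show ?thesis
    unfolding paid_def[abs_def] hub_paid_def[abs_def] serve_paid_def[abs_def] aide_paid_def[abs_def]
        received_def[abs_def] a total_add c
    by (simp add: algebra_simps)
qed

section \<open>Counting private neighbours and excess\<close>

definition excess :: "config \<Rightarrow> int" where
  "excess g = (if g (0, 0) then 0 else max (code_degree g - 2) 0)"

definition private_nbr :: "config \<Rightarrow> bool" where
  "private_nbr g \<longleftrightarrow> g (0, 0) \<and> \<not> g (1, 0) \<and> code_degree (shift 1 0 g) = 1"

definition no_private :: "config \<Rightarrow> bool" where
  "no_private g \<longleftrightarrow> g (0, 0) \<and> isolated g \<and> \<not> some_rot private_at g"

lemma private_nbr_iff: "private_nbr g \<longleftrightarrow> g (0, 0) \<and> \<not> g (1, 0)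
    \<and> \<not> g (2, 0) \<and> \<not> g (1, 1) \<and> \<not> g (0, 1) \<and> \<not> g (1, -1)
    \<and> \<not> g (2, -1)"
  unfolding private_nbr_def code_degree_def by (auto simp: of_bool_def)

lemma private_nbr_le:
  assumes "locating g"
  shows "cyc (\<lambda>g. of_bool (private_nbr g)) g \<le> of_bool (g (0, 0)) - of_bool (no_private g)"
proof (cases "g (0, 0)")
  case True
  have "\<not> (private_nbr f \<and> private_nbr (rot f))" "\<not> (private_nbr f
      \<and> private_nbr (rot2 f))" "\<not> (private_nbr f \<and> private_nbr (rot3 f))" if "locating f"
      "f (0, 0)" for f
    using locating_ring[OF that] that(2) unfolding private_nbr_iff by (simp; argo)+
  from this[of g] this[of "rot g"] this[of "rot2 g"] this[of "rot3 g"] this[of "rot4 g"]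
    this[of "rot5 g"]
  have 1: "cyc (\<lambda>g. of_bool (private_nbr g)) g \<le> 1"
    using assms True unfolding cyc_def
    by (cases "private_nbr g"; cases "private_nbr (rot g)"; cases "private_nbr (rot2 g)"; cases
        "private_nbr (rot3 g)"; cases "private_nbr (rot4 g)";
        cases "private_nbr (rot5 g)"; simp add: locating_rot rot_6)
  have 2: "cyc (\<lambda>g. of_bool (private_nbr g)) g = (0 :: int)" if "no_private g"
  proof -
    have "private_nbr f \<longrightarrow> private_at f" for f by (simp add: private_nbr_iff private_at_def)
    then show ?thesis using that unfolding no_private_def cyc_def some_rot_def by (simp; blast)
  qed
  show ?thesis using 1 2 True by (cases "no_private g") auto
next
  case False
  then show ?thesis by (simp add: cyc_def private_nbr_iff no_private_def)
qed

text \<open>Double counting: exactly one of the six rotations sees the only code neighbour, and a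
  unit shift with a half turn exchanges the two ends of that edge.\<close>

lemma total_private_nbr:
  assumes "0 < n"
  shows "total n d C (\<lambda>g. of_bool (\<not> g (0, 0) \<and> code_degree g = 1)) = total n d C
      (cyc (\<lambda>g. of_bool (private_nbr g)))"
proof -
  have e: "(\<lambda>g. of_bool (\<not> g (0, 0) \<and> code_degree g = 1)) = cyc (\<lambda>g. of_bool
      (\<not> g (0, 0) \<and> code_degree g = 1 \<and> g (1, 0)) :: int)"
  proof (rule ext)
    fix g :: config
    show "of_bool (\<not> g (0, 0) \<and> code_degree g = 1) = cyc (\<lambda>g. of_bool (\<not> g (0, 0)
        \<and> code_degree g = 1 \<and> g (1, 0)) :: int) g"
      unfolding cyc_def by (simp add: code_degree_rot) (auto simp: code_degree_def of_bool_def)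
  qed
  define F :: "config \<Rightarrow> int" where "F = (\<lambda>g. of_bool (\<not> g (0, 0)
      \<and> code_degree g = 1 \<and> g (1, 0)))"
  have "(\<lambda>g. F (rot3 (shift 1 0 g))) = (\<lambda>g. of_bool (private_nbr g))"
    by (auto simp: F_def private_nbr_def fun_eq_iff code_degree_rot)
  then have "total n d C (cyc (\<lambda>g. of_bool (private_nbr g))) = total n d C (cyc (\<lambda>g. F
      (rot3 (shift 1 0 g))))" by simp
  also have "\<dots> = total n d C (cyc (\<lambda>g. F (rot3 g)))"
    using total_cyc_shift[OF assms, of d C "\<lambda>g. F (rot3 g)" 1 0] .
  also have "\<dots> = total n d C (cyc F)"
    using cyc_comp_rot[of F, abs_def] cyc_comp_rot[of "\<lambda>g. F (rot g)", abs_def]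
        cyc_comp_rot[of "\<lambda>g. F (rot2 g)", abs_def] by simp
  finally show ?thesis using e by (simp add: F_def)
qed

definition excess_share :: "config \<Rightarrow> int" where
  "excess_share g = (if g (0, 0) \<and> isolated g then 26 * of_bool (trine g) + 78 * of_bool
      (irregular g) else 0)"

lemma charge_eq: "charge g = 78 * (of_bool (g (0, 0)) * code_degree g) + 78 * of_bool (no_private g) +
    cyc excess_share g"
proof (cases "g (0, 0) \<and> isolated g")
  case True
  have "code_degree g = 0" using True by (simp add: isolated_def code_degree_def)
  moreover have "cyc excess_share g = cyc (\<lambda>g. 26 * of_bool (trine g) + 78 * of_bool (irregular g)) g"
    using True by (simp add: cyc_def excess_share_def isolated_rot)
  ultimately show ?thesis using True by (simp add: charge_isolated no_private_def)
next
  case False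
  have "excess_share f = 0" if "f \<in> orbit g" for f
    using False orbit_invariant(2,3)[OF that] unfolding excess_share_def by presburger
  then have "cyc excess_share g = 0" by (simp add: cyc_def)
  then show ?thesis using False by (auto simp: charge_def no_private_def)
qed

text \<open>Seen from the covered vertex, a trine hands out at most three times 26. In the irregular
  case the codeword opposite the recipient has a code neighbour, as do the others, so only one share
  of 78 is claimed.\<close>

lemma total_excess_share:
  assumes "0 < n"
  shows "total n d C (cyc excess_share) \<le> 78 * total n d C excess"
proof -
  define S where "S = (\<lambda>g. excess_share (rot3 (shift 1 0 g)))"
  have le: "cyc S g \<le> 78 * excess g" for g
  proof -
    have b: "S g \<le> (if \<not> g (0, 0) \<and> g (1, 0) \<and> \<not> g (0, 1) \<and> \<not> g (1, -1) then
        26 * of_bool (\<not> g (-1, 0) \<and> g (0, -1) \<and> g (-1, 1)) + 78 * of_bool (g (-1, 0)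
            \<and> (g (0, -1) \<or> g (-1, 1))) else 0)" for g
      unfolding S_def excess_share_def trine_def irregular_def isolated_def by (auto simp: of_bool_def)
    have "cyc S g \<le> cyc (\<lambda>g. (if \<not> g (0, 0) \<and> g (1, 0) \<and> \<not> g (0, 1)
        \<and> \<not> g (1, -1) then
        26 * of_bool (\<not> g (-1, 0) \<and> g (0, -1) \<and> g (-1, 1)) + 78 * of_bool (g (-1, 0)
            \<and> (g (0, -1) \<or> g (-1, 1))) else 0)) g"
      by (rule cyc_le) (rule b)
    also have "\<dots> \<le> 78 * excess g"
      unfolding cyc_def excess_def code_degree_def
      by (cases "g (1, 0)"; cases "g (0, 1)"; cases "g (-1, 1)"; cases "g (-1, 0)"; cases "g (0, -1)";
          cases "g (1, -1)"; cases "g (0, 0)"; simp)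
    finally show ?thesis .
  qed
  have "total n d C (cyc excess_share) = total n d C (cyc (\<lambda>g. excess_share (rot3 g)))"
    using cyc_comp_rot[of excess_share, abs_def] cyc_comp_rot[of "\<lambda>g. excess_share (rot g)",
        abs_def] cyc_comp_rot[of "\<lambda>g. excess_share (rot2 g)", abs_def] by simp
  also have "\<dots> = total n d C (cyc S)"
    unfolding S_def using total_cyc_shift[OF assms, of d C "\<lambda>g. excess_share (rot3 g)" 1 0] by simp
  also have "\<dots> \<le> total n d C (\<lambda>g. 78 * excess g)"
    unfolding total_def by (rule sum_mono) (rule le)
  finally show ?thesis by (simp add: total_scale)
qed

lemma total_code_degree:
  assumes "0 < n"
  shows "total n d C code_degree = 6 * total n d C (\<lambda>g. of_bool (g (0, 0)))"
proof -
  have s: "total n d C (\<lambda>g. of_bool (g (a, b))) = total n d C (\<lambda>g. of_bool (g (0, 0)))"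
      for a b
    using total_shift[OF assms, of d C "\<lambda>g. of_bool (g (0, 0))" a b] by simp
  show ?thesis unfolding code_degree_def[abs_def] total_add s[of 1 0] s[of 0 1] s[of "-1" 1]
      s[of "-1" 0] s[of 0 "-1"] s[of 1 "-1"] by simp
qed

lemma code_degree_eq:
  assumes "locating g"
  shows "code_degree g = of_bool (g (0, 0)) * code_degree g + 2 - 2 * of_bool (g (0, 0)) + excess g -
      of_bool (\<not> g (0, 0) \<and> code_degree g = 1)"
proof -
  have "g (0, 0) \<or> 1 \<le> code_degree g" using locating_D(1)[OF assms, of 0 0]
    by (auto simp: locating_at_def code_degree_def)
  then show ?thesis by (auto simp: excess_def)
qed

lemma density_bound:
  assumes n: "0 < n" and locating: "\<And>i. locating (view n d C i)" and C: "C \<subseteq> {0..<n}"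
  shows "13 * n \<le> 57 * int (card C)"
proof -
  let ?t = "total n d C"
  define K where "K = ?t (\<lambda>g. of_bool (g (0, 0)))"
  have "K = (\<Sum>i\<in>{0..<n}. of_bool (i \<in> C))"
    unfolding K_def total_def by (rule sum.cong) (auto simp: view_def)
  also have "\<dots> = int (card C)"
    using C by (simp add: Int_commute Int_absorb2)
  finally have K: "K = int (card C)" .
  have mono: "(\<And>g. locating g \<Longrightarrow> F g \<le> G g) \<Longrightarrow> ?t F \<le> ?t G" for F G
    unfolding total_def by (rule sum_mono) (use locating in auto)
  have eq: "(\<And>g. locating g \<Longrightarrow> F g = G g) \<Longrightarrow> ?t F = ?t G" for F G
    unfolding total_def by (rule sum.cong) (use locating in auto)
  have "6 * K = ?t code_degree" by (simp add: K_def total_code_degree[OF n])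
  also have "\<dots> = ?t (\<lambda>g. of_bool (g (0, 0)) * code_degree g + 2 - 2 * of_bool (g (0, 0))
      + excess g - of_bool (\<not> g (0, 0) \<and> code_degree g = 1))"
    by (rule eq) (rule code_degree_eq)
  also have "\<dots> = ?t (\<lambda>g. of_bool (g (0, 0)) * code_degree g) + 2 * n - 2 * K + ?t excess
      - ?t (\<lambda>g. of_bool (\<not> g (0, 0) \<and> code_degree g = 1))"
    unfolding total_add total_diff total_scale K_def using n by (simp add: total_const)
  finally have 1: "6 * K = ?t (\<lambda>g. of_bool (g (0, 0)) * code_degree g) + 2 * n - 2 * K + ?t
      excess - ?t (\<lambda>g. of_bool (\<not> g (0, 0) \<and> code_degree g = 1))" .
  have 2: "?t (\<lambda>g. of_bool (\<not> g (0, 0) \<and> code_degree g = 1)) \<le> K - ?t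
      (\<lambda>g. of_bool (no_private g))"
  proof -
    have "?t (cyc (\<lambda>g. of_bool (private_nbr g))) \<le> ?t (\<lambda>g. of_bool (g (0, 0)) -
        of_bool (no_private g))"
      by (rule mono) (rule private_nbr_le)
    then show ?thesis by (simp add: total_private_nbr[OF n] total_diff K_def)
  qed
  have 3: "?t charge = 78 * ?t (\<lambda>g. of_bool (g (0, 0)) * code_degree g) + 78 * ?t (\<lambda>g.
      of_bool (no_private g)) + ?t (cyc excess_share)"
    unfolding charge_eq[abs_def] total_add total_scale ..
  have 4: "18 * K \<le> ?t charge + ?t (cyc received) - ?t (cyc paid)"
  proof -
    have "?t (\<lambda>g. 18 * of_bool (g (0, 0))) \<le> ?t (\<lambda>g. charge g + cyc received g -
        cyc paid g)"
      by (rule mono) (rule discharge)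
    then show ?thesis by (simp add: total_add total_diff total_scale K_def)
  qed
  \<comment> \<open>With \<open>E\<close> for the sum of the three kinds of excess, \<open>1\<close>
    and \<open>2\<close> give 9 K >= 2 n + E, and the other facts give 78 E >= 18 K. Together 684 K
    >= 156 n, which is twelve times the claim.\<close>
  show ?thesis using 1 2 3 4 total_excess_share[OF n, of d C] total_paid_eq_received[OF n, of d C] K
    by linarith
qed

section \<open>Locating-dominating codes in circulant graphs\<close>

text \<open>The hexagon around \<open>j\<close> when \<open>(x, y)\<close> stands for
  \<open>j + p * x + q * y\<close>. Keeping both steps as parameters lets one lemma serve all three
  rotations, since by \<open>star_sym\<close> the rotated pairs of steps give the same set.\<close>

definition star :: "int \<Rightarrow> int \<Rightarrow> int \<Rightarrow> int set" where
  "star p q j = {j, j + p, j + q, j + q - p, j - p, j - q, j + p - q}"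

lemma star_sym: "star 1 d j = star d (d - 1) j" "star 1 d j = star (d - 1) (-1) j"
  by (auto simp: star_def)

lemma I_set_circulant:
  assumes "0 < n"
  shows "I_set (circulant n {1, d - 1, d}) C (j mod n) = (\<lambda>k. k mod n) ` {k \<in> star 1 d j. k
      mod n \<in> C}"
proof -
  let ?u = "j mod n"
  have "closed_nbhd (circulant n {1, d - 1, d}) ?u = {?u, (?u + 1) mod n, (?u - 1) mod n, (?u + (d -
      1)) mod n,
      (?u - (d - 1)) mod n, (?u + d) mod n, (?u - d) mod n}"
    using assms by (auto simp: closed_nbhd_def circulant_def)
  also have "\<dots> = {j mod n, (j + 1) mod n, (j - 1) mod n, (j + (d - 1)) mod n,
      (j - (d - 1)) mod n, (j + d) mod n, (j - d) mod n}"
    by (simp only: mod_add_left_eq mod_diff_left_eq)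
  also have "\<dots> = (\<lambda>k. k mod n) ` star 1 d j"
    by (auto simp: star_def algebra_simps)
  finally show ?thesis unfolding I_set_def by auto
qed

lemma locating_at_of_locating_dominating:
  assumes n: "0 < n" and C: "locating_dominating (circulant n {1, d - 1, d}) C"
    and S: "\<And>j. star 1 d j = star p q j"
    and nz: "\<not> n dvd p" "\<not> n dvd p + q" "\<not> n dvd 2 * p"
  shows "locating_at (\<lambda>(x, y). (j + p * x + q * y) mod n \<in> C)"
proof -
  define W where "W k \<longleftrightarrow> k mod n \<in> C" for k
  let ?G = "circulant n {1, d - 1, d}"
  have I: "I_set ?G C (i mod n) = (\<lambda>k. k mod n) ` {k \<in> star p q i. W k}" for i
    using I_set_circulant[OF n, of d C i] by (simp add: S W_def)
  have V: "i mod n \<in> pverts ?G" for i using n by (simp add: circulant_def)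
  have dom: "\<exists>k\<in>star p q j. W k"
  proof -
    have "I_set ?G C (j mod n) \<noteq> {}"
      using C V unfolding locating_dominating_def dominating_def by blast
    then show ?thesis unfolding I by auto
  qed
  have sep: "{k \<in> star p q j. W k} \<noteq> {k \<in> star p q (j + e). W k}" if "\<not> n dvd e"
      "\<not> W j" "\<not> W (j + e)" for e
  proof
    assume "{k \<in> star p q j. W k} = {k \<in> star p q (j + e). W k}"
    then have "I_set ?G C (j mod n) = I_set ?G C ((j + e) mod n)" by (simp add: I)
    moreover have "j mod n \<noteq> (j + e) mod n" using that(1)
      by (metis add_diff_cancel_left' dvd_minus_iff minus_diff_eq mod_eq_dvd_iff)
    ultimately show False
      using C V that(2,3) unfolding locating_dominating_def W_def by blast
  qed
  have 1: "W j \<or> W (j + p) \<or> W (j + q) \<or> W (j + q - p) \<or> W (j - p) \<or> W (j - q)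
      \<or> W (j + p - q)"
    using dom unfolding star_def by auto
  have 2: "\<not> W j \<and> \<not> W (j + p) \<longrightarrow> W (j - p) \<or> W (j + q - p)
      \<or> W (j - q) \<or> W (j + 2 * p) \<or> W (j + p + q) \<or> W (j + 2 * p - q)"
  proof (intro impI, rule ccontr)
    assume a: "\<not> W j \<and> \<not> W (j + p)"
      "\<not> (W (j - p) \<or> W (j + q - p) \<or> W (j - q) \<or> W (j + 2 * p) \<or> W (j + p + q)
          \<or> W (j + 2 * p - q))"
    have e: "star p q (j + p) = {j + p, j + 2 * p, j + p + q, j + q, j, j + p - q, j + 2 * p - q}"
      unfolding star_def by auto
    have "{k \<in> star p q j. W k} = {k \<in> star p q (j + p). W k}"
      using a unfolding e unfolding star_def by auto
    with sep[OF nz(1)] a show False by blast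
  qed
  have 3: "\<not> W j \<and> \<not> W (j + p + q) \<longrightarrow> W (j + q - p) \<or> W (j - p)
      \<or> W (j - q) \<or> W (j + p - q) \<or>
      W (j + 2 * p + q) \<or> W (j + p + 2 * q) \<or> W (j + 2 * q) \<or> W (j + 2 * p)"
  proof (intro impI, rule ccontr)
    assume a: "\<not> W j \<and> \<not> W (j + p + q)"
      "\<not> (W (j + q - p) \<or> W (j - p) \<or> W (j - q) \<or> W (j + p - q) \<or>
      W (j + 2 * p + q) \<or> W (j + p + 2 * q) \<or> W (j + 2 * q) \<or> W (j + 2 * p))"
    have e: "star p q (j + (p + q)) = {j + p + q, j + 2 * p + q, j + p + 2 * q, j + 2 * q, j + q, j +
        p, j + 2 * p}"
      unfolding star_def by auto
    have "{k \<in> star p q j. W k} = {k \<in> star p q (j + (p + q)). W k}"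
      using a unfolding e unfolding star_def by auto
    with sep[OF nz(2)] a show False by (simp add: add.assoc)
  qed
  have 4: "\<not> W j \<and> \<not> W (j + 2 * p) \<longrightarrow> W (j + q) \<or> W (j + q - p)
      \<or> W (j - p) \<or> W (j - q) \<or> W (j + p - q) \<or>
      W (j + 3 * p) \<or> W (j + 2 * p + q) \<or> W (j + p + q) \<or> W (j + 2 * p - q)
          \<or> W (j + 3 * p - q)"
  proof (intro impI, rule ccontr)
    assume a: "\<not> W j \<and> \<not> W (j + 2 * p)"
      "\<not> (W (j + q) \<or> W (j + q - p) \<or> W (j - p) \<or> W (j - q) \<or> W (j + p - q) \<or>
      W (j + 3 * p) \<or> W (j + 2 * p + q) \<or> W (j + p + q) \<or> W (j + 2 * p - q)
          \<or> W (j + 3 * p - q))"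
    have e: "star p q (j + 2 * p) = {j + 2 * p, j + 3 * p, j + 2 * p + q, j + p + q, j + p, j + 2 * p -
        q, j + 3 * p - q}"
      unfolding star_def by auto
    have "{k \<in> star p q j. W k} = {k \<in> star p q (j + 2 * p). W k}"
      using a unfolding e unfolding star_def by auto
    with sep[OF nz(3)] a show False by blast
  qed
  show ?thesis
    using 1 2 3 4 unfolding locating_at_def W_def by (simp add: algebra_simps)
qed

text \<open>The nine conditions are \<open>p\<close>, \<open>p + q\<close> and \<open>2 * p\<close>
  for the three pairs of steps \<open>(1, d)\<close>, \<open>(d, d - 1)\<close> and
  \<open>(d - 1, -1)\<close>: up to sign, all displacements of length one and two.\<close>

lemma locating_view:
  assumes n: "0 < n" and C: "locating_dominating (circulant n {1, d - 1, d}) C"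
    and nz: "\<not> n dvd 1" "\<not> n dvd d" "\<not> n dvd d - 1" "\<not> n dvd d + 1"
        "\<not> n dvd 2 * d - 1" "\<not> n dvd d - 2"
      "\<not> n dvd 2" "\<not> n dvd 2 * d" "\<not> n dvd 2 * d - 2"
  shows "locating (view n d C i)"
proof -
  have "locating_at (view n d C j) \<and> locating_at (rot (view n d C j))
      \<and> locating_at (rot2 (view n d C j))" for j
  proof (intro conjI)
    show "locating_at (view n d C j)"
      using locating_at_of_locating_dominating[OF n C refl, of j] nz by (simp add: view_def algebra_simps)
    have e: "rot (view n d C j) = (\<lambda>(x, y). (j + d * x + (d - 1) * y) mod n \<in> C)"
      "rot2 (view n d C j) = (\<lambda>(x, y). (j + (d - 1) * x + (-1) * y) mod n \<in> C)"
      by (auto simp: view_def fun_eq_iff algebra_simps)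
    show "locating_at (rot (view n d C j))"
      unfolding e(1) by (rule locating_at_of_locating_dominating[OF n C star_sym(1)]) (use nz in
          \<open>simp_all add: algebra_simps\<close>)
    show "locating_at (rot2 (view n d C j))"
      unfolding e(2) by (rule locating_at_of_locating_dominating[OF n C star_sym(2)]) (use nz in
          \<open>simp_all add: algebra_simps\<close>)
  qed
  then show ?thesis unfolding locating_def shift_view by blast
qed

section \<open>The code of density 13/57\<close>

text \<open>As 8^2 - 8 + 1 = 57, multiplication by 8 modulo 57 is the rotation by 60 degrees, and
  the code is invariant under this rotation about 45. The codeword 45 has no private neighbour and
  is rich; 0, 6, 15 are the trine around 7 and 18, 27, 33 the one around 26; the other six are
  uncharged, with 45 directly behind them.\<close>

definition code_mod57 :: "int list" where
  "code_mod57 = [0, 2, 4, 6, 15, 18, 27, 29, 31, 33, 43, 45, 47]"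

text \<open>
  An integer determined by the set of codewords around \<open>r\<close>; that it already separates the
  non-codewords reduces separation to the distinctness of a list of numbers.
\<close>

definition signature57 :: "int \<Rightarrow> int" where
  "signature57 r = (\<Sum>e\<leftarrow>[0, 1, 8, 7, -1, -8, -7]. let s = (r + e) mod 57 in if s \<in>
      set code_mod57 then s ^ 3 + 1 else 0)"

lemma code_mod57_dominating: "\<forall>r\<in>set [0..56]. \<exists>e\<in>set [0, 1, 8, 7, -1, -8, -7].
    (r + e) mod 57 \<in> set code_mod57"
  unfolding code_mod57_def by code_simp

lemma code_mod57_separating: "distinct (map signature57 (filter (\<lambda>r. r \<notin> set code_mod57)
    [0..56]))"
  unfolding code_mod57_def signature57_def by code_simp

lemma signature57_inj:
  assumes "r \<in> {0..<57}" "r' \<in> {0..<57}" "r \<notin> set code_mod57"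
      "r' \<notin> set code_mod57" "signature57 r = signature57 r'"
  shows "r = r'"
proof -
  have "inj_on signature57 (set (filter (\<lambda>r. r \<notin> set code_mod57) [0..56]))"
    using code_mod57_separating by (simp add: distinct_map)
  moreover have "r \<in> set (filter (\<lambda>r. r \<notin> set code_mod57) [0..56])"
      "r' \<in> set (filter (\<lambda>r. r \<notin> set code_mod57) [0..56])"
    using assms by auto
  ultimately show ?thesis using assms(5) by (auto dest: inj_onD)
qed

definition star_mod57 :: "int \<Rightarrow> int set" where
  "star_mod57 r = (\<lambda>e. (r + e) mod 57) ` {0, 1, 8, 7, -1, -8, -7}"

text \<open>The seven residues are distinct, so the sum over a list depends only on the set of
  codewords seen.\<close>

lemma signature57_eq: "signature57 r = (\<Sum>s\<in>star_mod57 r \<inter> set code_mod57. s ^ 3 + 1)"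
proof -
  let ?E = "{0, 1, 8, 7, -1, -8, -7} :: int set"
  have inj: "inj_on (\<lambda>e. (r + e) mod 57) ?E"
  proof (rule inj_onI)
    fix e e' assume e: "e \<in> ?E" "e' \<in> ?E" "(r + e) mod 57 = (r + e') mod 57"
    then have "57 dvd e - e'" by (metis add_diff_cancel_left mod_eq_dvd_iff)
    then show "e = e'" using e by auto
  qed
  have "signature57 r = (\<Sum>e\<in>?E. if (r + e) mod 57 \<in> set code_mod57 then ((r + e) mod 57) ^
      3 + 1 else 0)"
    by (simp add: signature57_def Let_def)
  also have "\<dots> = (\<Sum>s\<in>star_mod57 r. if s \<in> set code_mod57 then s ^ 3 + 1 else 0)"
    unfolding star_mod57_def by (subst sum.reindex[OF inj]) (simp only: comp_def)
  also have "\<dots> = (\<Sum>s\<in>star_mod57 r \<inter> set code_mod57. s ^ 3 + 1)"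
    by (rule sum.inter_restrict[symmetric]) (simp add: star_mod57_def)
  finally show ?thesis .
qed

section \<open>Lifting the code to multiples of 57\<close>

definition periodic_code :: "int \<Rightarrow> int set" where
  "periodic_code n = {u \<in> {0..<n}. u mod 57 \<in> set code_mod57}"

lemma card_periodic_code:
  assumes "0 \<le> m"
  shows "int (card (periodic_code (57 * m))) = 13 * m"
proof -
  have S: "set code_mod57 \<subseteq> {0..<57}" "card (set code_mod57) = 13" by (auto simp: code_mod57_def)
  have "bij_betw (\<lambda>(q, r). 57 * q + r) ({0..<m} \<times> set code_mod57) (periodic_code (57 * m))"
  proof (rule bij_betw_byWitness[where f' = "\<lambda>u. (u div 57, u mod 57)"])
    show "\<forall>a\<in>{0..<m} \<times> set code_mod57. (\<lambda>u. (u div 57, u mod 57))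
        ((\<lambda>(q, r). 57 * q + r) a) = a"
      using S by (force simp: div_add1_eq)
    show "\<forall>a'\<in>periodic_code (57 * m). (\<lambda>(q, r). 57 * q + r) (a' div 57, a' mod 57) = a'"
      by simp
    show "(\<lambda>(q, r). 57 * q + r) ` ({0..<m} \<times> set code_mod57) \<subseteq> periodic_code
        (57 * m)"
      using S(1) by (fastforce simp: periodic_code_def subset_iff)
    show "(\<lambda>u. (u div 57, u mod 57)) ` periodic_code (57 * m) \<subseteq> {0..<m} \<times> set
        code_mod57"
      by (auto simp: periodic_code_def)
  qed
  then have "card (periodic_code (57 * m)) = card ({0..<m} \<times> set code_mod57)"
    by (simp add: bij_betw_same_card)
  then show ?thesis using assms S by (simp add: card_cartesian_product)
qed

lemma periodic_code_locating_dominating: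
  assumes n: "0 < n" "57 dvd n" and d: "d mod 57 = 8"
  shows "locating_dominating (circulant n {1, d - 1, d}) (periodic_code n)"
proof -
  let ?G = "circulant n {1, d - 1, d}" and ?C = "periodic_code n"
  have m57: "(k mod n) mod 57 = k mod 57" for k using n(2) by (rule mod_mod_cancel)
  have C: "k mod n \<in> ?C \<longleftrightarrow> k mod 57 \<in> set code_mod57" for k using n m57
    by (simp add: periodic_code_def)
  have st: "(\<lambda>k. k mod 57) ` star 1 d j = star_mod57 (j mod 57)" for j
  proof -
    obtain t where t: "d = 57 * t + 8" using d by (metis mult.commute div_mult_mod_eq)
    have "j + d = j + 8 + 57 * t" "j - d = j + (-8) + 57 * (- t)" "j + d - 1 = j + 7 + 57 * t"
        "j + 1 - d = j + (-7) + 57 * (- t)"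
      using t by simp_all
    then have "(j + d) mod 57 = (j mod 57 + 8) mod 57" "(j - d) mod 57 = (j mod 57 + (-8)) mod 57"
      "(j + d - 1) mod 57 = (j mod 57 + 7) mod 57" "(j + 1 - d) mod 57 = (j mod 57 + (-7)) mod 57"
      "(j + 1) mod 57 = (j mod 57 + 1) mod 57" "(j - 1) mod 57 = (j mod 57 + (-1)) mod 57"
      by (simp_all only: mod_mult_self2 mod_add_left_eq diff_conv_add_uminus)
    then show ?thesis
      by (simp only: star_def star_mod57_def image_insert image_empty add_0_right mod_mod_trivial)
  qed
  have I: "I_set ?G ?C (j mod n) = (\<lambda>k. k mod n) ` {k \<in> star 1 d j. k mod 57 \<in> set
      code_mod57}" for j
    using I_set_circulant[OF n(1), of d ?C j] by (simp add: C)
  have J: "(\<lambda>k. k mod 57) ` I_set ?G ?C (j mod n) = star_mod57 (j mod 57) \<inter> set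
      code_mod57" for j
    unfolding I st[symmetric] by (auto simp: image_image m57)
  have ne: "I_set ?G ?C (j mod n) \<noteq> {}" for j
  proof -
    have "j mod 57 \<in> set [0..56]" by auto
    then have "star_mod57 (j mod 57) \<inter> set code_mod57 \<noteq> {}"
      using code_mod57_dominating unfolding star_mod57_def by fastforce
    then show ?thesis using J[of j] by auto
  qed
  have V: "pverts ?G = {0..<n}" by (simp add: circulant_def)
  have code: "is_code ?G ?C"
  proof -
    have "0 \<in> ?C" using n by (simp add: periodic_code_def code_mod57_def)
    then show ?thesis unfolding is_code_def V by (auto simp: periodic_code_def)
  qed
  have dom: "dominating ?G ?C"
    unfolding dominating_def V
  proof (intro conjI ballI)
    fix u assume "u \<in> {0..<n}"
    then show "I_set ?G ?C u \<noteq> {}" using ne[of u] by simp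
  qed (rule code)
  moreover have "u = v" if u: "u \<in> {0..<n} - ?C" and v: "v \<in> {0..<n} - ?C" and e: "I_set ?G ?C
      u = I_set ?G ?C v" for u v
  proof -
    have um: "u mod n = u" "v mod n = v" using u v by auto
    have "star_mod57 (u mod 57) \<inter> set code_mod57 = star_mod57 (v mod 57) \<inter> set code_mod57"
      using J[of u] J[of v] e um by simp
    then have "signature57 (u mod 57) = signature57 (v mod 57)" by (simp add: signature57_eq)
    moreover have "u mod 57 \<notin> set code_mod57" "v mod 57 \<notin> set code_mod57"
      using u v unfolding periodic_code_def by blast+
    ultimately have r: "u mod 57 = v mod 57"
      by (intro signature57_inj[of "u mod 57" "v mod 57"]) simp_all
    have si: "star 1 d j = (\<lambda>a. j + a) ` {0, 1, d, d - 1, -1, - d, 1 - d}" for j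
      unfolding star_def by (auto simp: algebra_simps)
    \<comment> \<open>Congruence modulo 57 does not yet give \<open>u = v\<close>. A codeword seen
      by both is reached from \<open>u\<close> and \<open>v\<close> by steps \<open>a\<close> and
      \<open>b\<close> that agree modulo 57, and the seven possible steps are distinct there, so
      \<open>a = b\<close>.\<close>
    obtain w where w: "w \<in> I_set ?G ?C u" using ne[of u] um by auto
    have "w \<in> (\<lambda>k. k mod n) ` star 1 d u" using w I[of u] um by auto
    then obtain a where a: "a \<in> {0, 1, d, d - 1, -1, - d, 1 - d}" "w = (u + a) mod n"
      unfolding si by blast
    have "w \<in> (\<lambda>k. k mod n) ` star 1 d v" using w I[of v] um e by auto
    then obtain b where b: "b \<in> {0, 1, d, d - 1, -1, - d, 1 - d}" "w = (v + b) mod n"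
      unfolding si by blast
    have ab: "(u + a) mod n = (v + b) mod n" using a(2) b(2) by simp
    then have "(u + a) mod 57 = (v + b) mod 57" using m57 by metis
    then have "57 dvd (u + a) - (v + b)" by (simp only: mod_eq_dvd_iff)
    moreover have "57 dvd u - v" using r by (simp only: mod_eq_dvd_iff)
    moreover have "a - b = ((u + a) - (v + b)) - (u - v)" by simp
    ultimately have "57 dvd a - b" by (metis dvd_diff)
    then have m: "a mod 57 = b mod 57" by (simp only: mod_eq_dvd_iff)
    obtain t where t: "d = 57 * t + 8" using d by (metis mult.commute div_mult_mod_eq)
    have "d - 1 = 7 + 57 * t" "- d = 49 + 57 * (- t - 1)" "1 - d = 50 + 57 * (- t - 1)" using t by simp_all
    then have dm: "(d - 1) mod 57 = 7" "(- d) mod 57 = 49" "(1 - d) mod 57 = 50"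
      by (simp_all only: mod_mult_self2) simp_all
    have "(x = 0 \<and> x mod 57 = 0) \<or> (x = 1 \<and> x mod 57 = 1) \<or> (x = d
        \<and> x mod 57 = 8) \<or> (x = d - 1 \<and> x mod 57 = 7)
       \<or> (x = -1 \<and> x mod 57 = 56) \<or> (x = - d \<and> x mod 57 = 49) \<or> (x = 1 - d
           \<and> x mod 57 = 50)"
      if "x \<in> {0, 1, d, d - 1, -1, - d, 1 - d}" for x
      using that by (elim insertE emptyE) (simp_all add: dm d)
    from this[OF a(1)] this[OF b(1)] m have "a = b" by (elim disjE conjE) simp_all
    then have "u mod n = v mod n" using ab by (metis add_diff_cancel_right' mod_diff_left_eq)
    then show ?thesis using um by simp
  qed
  ultimately show ?thesis unfolding locating_dominating_def V by blast
qed

lemma gamma_LD_circulant: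
  assumes "[d = 8] (mod 57)" "8 \<le> d" "2 * d \<le> n" "[n = 0] (mod 57)"
  shows "57 * int (gamma_LD (circulant n {1, d - 1, d})) = 13 * n"
proof -
  let ?G = "circulant n {1, d - 1, d}"
  have n: "0 < n" "57 dvd n" and d: "d mod 57 = 8" using assms by (auto simp: cong_def)
  have fin: "finite (pverts ?G)" "pverts ?G \<noteq> {}" using n by (auto simp: circulant_def)
  obtain C where C: "locating_dominating ?G C" "card C = gamma_LD ?G"
    using gamma_LD_attained(1)[OF fin] by blast
  have nd: "\<not> n dvd k" if "\<not> 57 dvd k" for k using that n(2) by (meson dvd_trans)
  have "C \<subseteq> {0..<n}" using C(1)
    by (simp add: locating_dominating_def dominating_def is_code_def circulant_def)
  moreover have "locating (view n d C i)" for i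
  proof (rule locating_view[OF n(1) C(1)])
    obtain t where t: "d = 57 * t + 8" using d by (metis mult.commute div_mult_mod_eq)
    \<comment> \<open>Modulo 57 these numbers are 1, 8, 7, 9, 15, 6, 2, 16 and 14.\<close>
    show "\<not> n dvd 1" "\<not> n dvd d" "\<not> n dvd d - 1" "\<not> n dvd d + 1"
        "\<not> n dvd 2 * d - 1" "\<not> n dvd d - 2"
      "\<not> n dvd 2" "\<not> n dvd 2 * d" "\<not> n dvd 2 * d - 2"
      unfolding t by (rule nd, presburger)+
  qed
  ultimately have "13 * n \<le> 57 * int (card C)" by (intro density_bound[OF n(1)])
  moreover obtain m where m: "n = 57 * m" using n(2) by (elim dvdE)
  have "int (gamma_LD ?G) \<le> 13 * m"
    using gamma_LD_attained(2)[OF fin periodic_code_locating_dominating[OF n d]]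
        card_periodic_code[of m] m n by simp
  ultimately show ?thesis using C(2) m by simp
qed

section \<open>Identifying codes of density 1/4\<close>

definition hexagon :: "(int \<times> int) list" where
  "hexagon = [(0, 0), (1, 0), (0, 1), (-1, 1), (-1, 0), (0, -1), (1, -1)]"

lemma star_hexagon: "star 1 d j = (\<lambda>(a, b). j + a + d * b) ` set hexagon"
  by (auto simp: star_def hexagon_def)

lemma even_lattice_dominates: "\<exists>(a, b)\<in>set hexagon. even (x + a) \<and> even (y + b)"
  by (cases "even x"; cases "even y") (auto simp: hexagon_def)

text \<open>
  Some point with even coordinates lies in the hexagon around \<open>(x, y)\<close>, but not in the one
  around \<open>(x + D, y + E)\<close>.
\<close>

definition escape :: "int \<Rightarrow> int \<Rightarrow> int \<Rightarrow> int \<Rightarrow> bool" where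
  "escape D E x y \<longleftrightarrow> list_ex (\<lambda>(a, b). even (x + a) \<and> even (y + b)
      \<and> (a - D, b - E) \<notin> set hexagon) hexagon"

lemma escape_mod_2: "escape D E (x mod 2) (y mod 2) \<longleftrightarrow> escape D E x y"
  by (simp add: escape_def)

text \<open>Vertices that see a common codeword differ by one of these vectors; all other pairs are
  separated by domination.\<close>

definition hexagon_diffs :: "(int \<times> int) list" where
  "hexagon_diffs = [(-2, 0), (-2, 1), (-2, 2), (-1, -1), (-1, 0), (-1, 1), (-1, 2), (0, -2), (0, -1),
      (0, 1), (0, 2), (1, -2), (1, -1), (1, 0), (1, 1), (2, -2), (2, -1), (2, 0)]"

lemma hexagon_diff:
  assumes "(a, b) \<in> set hexagon" "(a', b') \<in> set hexagon" "(a, b) \<noteq> (a', b')"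
  shows "(a - a', b - b') \<in> set hexagon_diffs"
proof -
  have "list_all (\<lambda>p. list_all (\<lambda>q. p = q \<or> (fst p - fst q, snd p - snd q) \<in>
      set hexagon_diffs) hexagon) hexagon"
    unfolding hexagon_diffs_def hexagon_def by code_simp
  then show ?thesis using assms unfolding list_all_iff by fastforce
qed

lemma escape_small: "list_all (\<lambda>(D, E). list_all (\<lambda>(x, y). escape D E x y
    \<or> escape (- D) (- E) (x + D) (y + E))
    [(0, 0), (0, 1), (1, 0), (1, 1)]) hexagon_diffs"
  unfolding hexagon_diffs_def escape_def hexagon_def by code_simp

lemma even_lattice_separates:
  assumes "(D, E) \<in> set hexagon_diffs"
  shows "escape D E x y \<or> escape (- D) (- E) (x + D) (y + E)"
proof -
  have "(x mod 2, y mod 2) \<in> set [(0, 0), (0, 1), (1, 0), (1, 1)]" by auto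
  then have "escape D E (x mod 2) (y mod 2) \<or> escape (- D) (- E) (x mod 2 + D) (y mod 2 + E)"
    using escape_small assms unfolding list_all_iff by fastforce
  then show ?thesis
    using escape_mod_2[of "- D" "- E" "x mod 2 + D" "y mod 2 + E"] escape_mod_2[of "- D" "- E" "x + D"
        "y + E"]
    by (simp only: escape_mod_2 mod_add_left_eq)
qed

text \<open>The number 6 of rows is even, so wrapping around preserves the parity of a row, and it
  exceeds 4, the largest row distance that arises when two hexagons around nearby vertices are
  compared. The width 3 on each side of the seam is a displacement of at most 2 plus a hexagon step
  of 1.\<close>

definition seamed_code :: "int \<Rightarrow> int set" where
  "seamed_code d = {i \<in> {0..<6 * d}. even (i div d) \<and> even (i mod d) \<or> i mod d < 3
      \<or> d - 3 \<le> i mod d}"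

lemma seamed_code_iff:
  assumes "0 < d"
  shows "k mod (6 * d) \<in> seamed_code d \<longleftrightarrow> even (k div d) \<and> even (k mod d)
      \<or> k mod d < 3 \<or> d - 3 \<le> k mod d"
proof -
  have "k mod (6 * d) = d * (k div d mod 6) + k mod d"
    using zmod_zmult2_eq[of 6 k d] by (simp add: mult.commute)
  moreover have "0 \<le> k mod d" "k mod d < d" using assms by auto
  ultimately have "k mod (6 * d) div d = k div d mod 6" "k mod (6 * d) mod d = k mod d"
    using assms by simp_all
  moreover have "even (t mod 6) = even t" for t :: int by presburger
  ultimately show ?thesis using assms by (simp add: seamed_code_def)
qed

text \<open>The coordinates \<open>j mod d\<close> and \<open>j div d\<close> are continued past the
  end of a row, where the true row and column differ from the continued ones. Such a point lands in
  a seam column, so every point with even continued coordinates within reach is a codeword all the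
  same.\<close>

lemma seamed_code_mem:
  assumes d: "16 \<le> d" and a: "\<bar>a\<bar> \<le> 3" and e: "even (j mod d + a)" "even (j div d + b)"
  shows "(j + a + d * b) mod (6 * d) \<in> seamed_code d"
proof -
  define x y where "x = j mod d" and "y = j div d"
  have d0: "0 < d" using d by simp
  have x: "0 \<le> x" "x < d" using d by (auto simp: x_def)
  have j: "j = d * y + x" by (simp add: x_def y_def)
  consider "0 \<le> x + a" "x + a < d" | "x + a < 0" | "d \<le> x + a" by linarith
  then show ?thesis
  proof cases
    case 1
    have k: "j + a + d * b = d * (y + b) + (x + a)" by (simp add: j algebra_simps)
    have "(j + a + d * b) div d = y + b" "(j + a + d * b) mod d = x + a"
      unfolding k using 1 d by simp_all
    then show ?thesis using e d by (simp add: seamed_code_iff x_def y_def)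
  next
    case 2
    have k: "j + a + d * b = d * (y + b - 1) + (x + a + d)" by (simp add: j algebra_simps)
    have "(j + a + d * b) mod d = x + a + d"
      unfolding k mod_mult_self4 using 2 x a d by (intro mod_pos_pos_trivial) simp_all
    then have "d - 3 \<le> (j + a + d * b) mod d" using x a by linarith
    then show ?thesis unfolding seamed_code_iff[OF d0] by blast
  next
    case 3
    have k: "j + a + d * b = d * (y + b + 1) + (x + a - d)" by (simp add: j algebra_simps)
    have "(j + a + d * b) mod d = x + a - d"
      unfolding k mod_mult_self4 using 3 x a d by (intro mod_pos_pos_trivial) simp_all
    then have "(j + a + d * b) mod d < 3" using x a by linarith
    then show ?thesis unfolding seamed_code_iff[OF d0] by blast
  qed
qed

lemma hexagon_small: "(a, b) \<in> set hexagon \<Longrightarrow> \<bar>a\<bar> \<le> 1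
    \<and> \<bar>b\<bar> \<le> 1"
  by (auto simp: hexagon_def)

lemma star_disjoint:
  assumes d: "16 \<le> d" and c: "(a, b) \<in> set hexagon" "(a - D, b - E) \<notin> set hexagon" and
      D: "\<bar>D\<bar> \<le> 2" "\<bar>E\<bar> \<le> 2"
  shows "(j + a + d * b) mod (6 * d) \<notin> (\<lambda>k. k mod (6 * d)) ` star 1 d (j + D + d * E)"
proof
  assume "(j + a + d * b) mod (6 * d) \<in> (\<lambda>k. k mod (6 * d)) ` star 1 d (j + D + d * E)"
  then obtain a' b' where h: "(a', b') \<in> set hexagon" "(j + a + d * b) mod (6 * d) = (j + D + d * E
      + a' + d * b') mod (6 * d)"
    unfolding star_hexagon by auto
  define s t where "s = a - D - a'" and "t = b - E - b'"
  have st: "\<bar>s\<bar> \<le> 4" "\<bar>t\<bar> \<le> 4"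
    using hexagon_small[OF c(1)] hexagon_small[OF h(1)] D unfolding s_def t_def by linarith+
  have "6 * d dvd s + d * t"
  proof -
    have "(j + a + d * b) - (j + D + d * E + a' + d * b') = s + d * t"
      by (simp add: s_def t_def algebra_simps)
    then show ?thesis using h(2) by (metis mod_eq_dvd_iff)
  qed
  then obtain m where m: "s + d * t = 6 * d * m" by (elim dvdE)
  then have "d dvd s" by (metis dvd_add_left_iff dvd_triv_left dvd_mult dvd_mult2 mult.commute)
  then have s: "s = 0" using st(1) d zdvd_not_zless[of "\<bar>s\<bar>" d] by fastforce
  then have "t = 6 * m" using m d by simp
  then have "t = 0" using st(2) by presburger
  then have "(a - D, b - E) = (a', b')" using s by (simp add: s_def t_def)
  then show False using c(2) h(1) by simp
qed

lemma seamed_code_identifying: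
  assumes d: "16 \<le> d"
  shows "identifying (circulant (6 * d) {1, d - 1, d}) (seamed_code d)"
proof -
  let ?n = "6 * d" and ?C = "seamed_code d"
  let ?G = "circulant ?n {1, d - 1, d}"
  have n: "0 < ?n" using d by simp
  have I: "I_set ?G ?C (j mod ?n) = (\<lambda>k. k mod ?n) ` {k \<in> star 1 d j. k mod ?n \<in> ?C}" for j
    by (rule I_set_circulant[OF n])
  have V: "pverts ?G = {0..<?n}" by (simp add: circulant_def)
  have ne: "I_set ?G ?C (j mod ?n) \<noteq> {}" for j
  proof -
    obtain a b where ab: "(a, b) \<in> set hexagon" "even (j mod d + a)" "even (j div d + b)"
      using even_lattice_dominates by blast
    then have "(j + a + d * b) mod ?n \<in> ?C"
      using hexagon_small[OF ab(1)] by (intro seamed_code_mem d) auto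
    moreover have "j + a + d * b \<in> star 1 d j" using ab(1) unfolding star_hexagon by force
    ultimately show ?thesis unfolding I by auto
  qed
  have "0 \<in> ?C" using d by (simp add: seamed_code_def)
  moreover have "?C \<subseteq> {0..<?n}" by (auto simp: seamed_code_def)
  ultimately have "is_code ?G ?C" unfolding is_code_def V by blast
  then have dom: "dominating ?G ?C"
    unfolding dominating_def V using ne by (metis atLeastLessThan_iff mod_pos_pos_trivial)
  \<comment> \<open>Both vertices are described in the continued coordinates of \<open>u\<close>, so
    that all parities refer to one system even across the seam.\<close>
  have sep: "I_set ?G ?C (j mod ?n) \<noteq> I_set ?G ?C ((j + D + d * E) mod ?n)"
    if esc: "escape D E (u mod d + r) (u div d + s)" and DE: "\<bar>D\<bar> \<le> 2"
        "\<bar>E\<bar> \<le> 2" and r: "\<bar>r\<bar> \<le> 2" and j: "j = u + r + d * s" for j D E u r s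
  proof -
    obtain a b where ab: "(a, b) \<in> set hexagon" "(a - D, b - E) \<notin> set hexagon"
        "even (u mod d + r + a)" "even (u div d + s + b)"
      using esc unfolding escape_def list_ex_iff by (auto simp del: even_add)
    have "(u + (r + a) + d * (s + b)) mod ?n \<in> ?C"
      using hexagon_small[OF ab(1)] ab r by (intro seamed_code_mem d) (auto simp: add.assoc)
    then have "(j + a + d * b) mod ?n \<in> ?C" using j by (simp add: algebra_simps)
    moreover have "j + a + d * b \<in> star 1 d j" using ab(1) unfolding star_hexagon by force
    ultimately have "(j + a + d * b) mod ?n \<in> I_set ?G ?C (j mod ?n)" unfolding I by blast
    moreover have "(j + a + d * b) mod ?n \<notin> I_set ?G ?C ((j + D + d * E) mod ?n)"
      using star_disjoint[OF d ab(1,2) DE] unfolding I by blast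
    ultimately show ?thesis by blast
  qed
  have "u = v" if u: "u \<in> {0..<?n}" and v: "v \<in> {0..<?n}" and e: "I_set ?G ?C u = I_set ?G ?C
      v" for u v
  proof (rule ccontr)
    assume uv: "u \<noteq> v"
    have um: "u mod ?n = u" "v mod ?n = v" using u v by auto
    obtain w where w: "w \<in> I_set ?G ?C u" using ne[of u] um by auto
    have "w \<in> (\<lambda>k. k mod ?n) ` star 1 d u" using w I[of u] um by auto
    then obtain a b where a: "(a, b) \<in> set hexagon" "w = (u + a + d * b) mod ?n"
      unfolding star_hexagon by auto
    have "w \<in> (\<lambda>k. k mod ?n) ` star 1 d v" using w e I[of v] um by auto
    then obtain a' b' where a': "(a', b') \<in> set hexagon" "w = (v + a' + d * b') mod ?n"
      unfolding star_hexagon by auto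
    define D E where "D = a - a'" and "E = b - b'"
    have DE: "\<bar>D\<bar> \<le> 2" "\<bar>E\<bar> \<le> 2"
      using hexagon_small[OF a(1)] hexagon_small[OF a'(1)] unfolding D_def E_def by linarith+
    define j where "j = u + D + d * E"
    have "v mod ?n = j mod ?n"
    proof -
      have "((u + a + d * b) - (a' + d * b')) mod ?n = ((v + a' + d * b') - (a' + d * b')) mod ?n"
        using a(2) a'(2) by (metis mod_diff_left_eq)
      then show ?thesis by (simp add: j_def D_def E_def algebra_simps)
    qed
    then have j: "j mod ?n = v" using um by simp
    have ab: "(a, b) \<noteq> (a', b')"
    proof
      assume "(a, b) = (a', b')"
      then have "j = u" by (simp add: j_def D_def E_def)
      then show False using j um uv by simp
    qed
    have "(D, E) \<in> set hexagon_diffs" unfolding D_def E_def by (rule hexagon_diff[OF a(1) a'(1) ab])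
    from even_lattice_separates[OF this, of "u mod d" "u div d"]
    show False
    proof
      assume "escape D E (u mod d) (u div d)"
      then have "I_set ?G ?C (u mod ?n) \<noteq> I_set ?G ?C ((u + D + d * E) mod ?n)"
        using DE by (intro sep[where u = u and r = 0 and s = 0]) simp_all
      then show False using e j um by (simp add: j_def)
    next
      assume "escape (- D) (- E) (u mod d + D) (u div d + E)"
      then have "I_set ?G ?C (j mod ?n) \<noteq> I_set ?G ?C ((j + (- D) + d * (- E)) mod ?n)"
        using DE by (intro sep[where u = u and r = D and s = E]) (simp_all add: j_def)
      moreover have "j + (- D) + d * (- E) = u" by (simp add: j_def)
      ultimately show False using e j um by simp
    qed
  qed
  then show ?thesis unfolding identifying_def V using dom by blast
qed

section \<open>Size and density of the seamed code\<close>

lemma card_seamed_code: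
  fixes e :: nat
  assumes "8 \<le> e"
  shows "3 * e \<le> card (seamed_code (2 * int e))" "card (seamed_code (2 * int e)) \<le> 3 * e + 36"
proof -
  let ?d = "2 * int e"
  define A where "A = (\<lambda>(y, t). ?d * y + 2 * t) ` ({0, 2, 4} \<times> {0..<int e})"
  define B where "B = (\<lambda>(y, x). ?d * y + x) ` ({0, 1, 2, 3, 4, 5} \<times> {0, 1, 2, ?d - 3, ?d
      - 2, ?d - 1})"
  have "inj_on (\<lambda>(y, t). ?d * y + 2 * t) ({0, 2, 4} \<times> {0..<int e})"
    by (auto simp: inj_on_def)
  then have A: "card A = 3 * e" by (simp add: A_def card_image card_cartesian_product)
  have "card B \<le> card ({0, 1, 2, 3, 4, 5 :: int} \<times> {0, 1, 2, ?d - 3, ?d - 2, ?d - 1})"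
    unfolding B_def by (rule card_image_le) simp
  \<comment> \<open>Six rows with six seam columns each.\<close>
  also have "\<dots> \<le> 36" using assms by (simp add: card_cartesian_product card_insert_if)
  finally have B: "card B \<le> 36" .
  have fin: "finite (seamed_code ?d)"
    by (rule finite_subset[of _ "{0..<6 * ?d}"]) (auto simp: seamed_code_def)
  have "A \<subseteq> seamed_code ?d"
  proof
    fix i assume "i \<in> A"
    then obtain p where p: "p \<in> {0, 2, 4} \<times> {0..<int e}" "i = (\<lambda>(y, t). ?d * y + 2 *
        t) p" unfolding A_def by blast
    obtain y t where "p = (y, t)" by (cases p)
    with p have i: "i = ?d * y + 2 * t" "y \<in> {0, 2, 4}" "0 \<le> t" "t < int e" by auto
    have "i div ?d = y" "i mod ?d = 2 * t" using i by simp_all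
    moreover have "0 \<le> i" "i < 6 * ?d" using i by auto
    ultimately show "i \<in> seamed_code ?d" using i by (auto simp: seamed_code_def)
  qed
  then show "3 * e \<le> card (seamed_code ?d)" using A card_mono[OF fin] by metis
  have "seamed_code ?d \<subseteq> A \<union> B"
  proof
    fix i assume i: "i \<in> seamed_code ?d"
    define y x where "y = i div ?d" and "x = i mod ?d"
    have yx: "i = ?d * y + x" by (simp add: y_def x_def)
    have x: "0 \<le> x" "x < ?d" using assms by (simp_all add: x_def)
    have "0 \<le> i" "i < ?d * 6" using i by (simp_all add: seamed_code_def)
    then have "0 \<le> y" using assms by (simp add: y_def pos_imp_zdiv_nonneg_iff)
    moreover have "?d * y < ?d * 6" using \<open>i < ?d * 6\<close> yx x by linarith
    then have "y < 6" by (simp only: mult_less_cancel_left)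
    ultimately have y: "y \<in> {0, 1, 2, 3, 4, 5}" by auto
    consider "even y" "even x" | "x < 3" | "?d - 3 \<le> x" using i
      by (auto simp: seamed_code_def x_def y_def)
    then show "i \<in> A \<union> B"
    proof cases
      case 1
      then have "y \<in> {0, 2, 4}" "x = 2 * (x div 2)" "x div 2 \<in> {0..<int e}" using y x by auto
      then have "i \<in> A" unfolding A_def using yx
        by (metis (no_types, lifting) case_prod_conv imageI mem_Sigma_iff)
      then show ?thesis ..
    next
      case 2
      then have "x \<in> {0, 1, 2, ?d - 3, ?d - 2, ?d - 1}" using x by auto
      then have "i \<in> B" unfolding B_def using yx y
        by (metis (no_types, lifting) case_prod_conv imageI mem_Sigma_iff)
      then show ?thesis ..
    next
      case 3
      then have "x \<in> {0, 1, 2, ?d - 3, ?d - 2, ?d - 1}" using x by auto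
      then have "i \<in> B" unfolding B_def using yx y
        by (metis (no_types, lifting) case_prod_conv imageI mem_Sigma_iff)
      then show ?thesis ..
    qed
  qed
  then have "card (seamed_code ?d) \<le> card (A \<union> B)" by (intro card_mono) (auto simp: A_def B_def)
  also have "\<dots> \<le> card A + card B" by (rule card_Un_le)
  finally show "card (seamed_code ?d) \<le> 3 * e + 36" using A B by simp
qed

lemma identifying_codes_density_quarter:
  defines "d \<equiv> \<lambda>k. 2 * int (k + 8)"
  shows "(\<lambda>k. real (card (seamed_code (d k))) / real_of_int (6 * d k))
      \<longlonglongrightarrow> 1 / 4"
proof (rule tendsto_sandwich)
  show "\<forall>\<^sub>F k in sequentially. 1 / 4 \<le> real (card (seamed_code (d k))) / real_of_int
      (6 * d k)"
  proof (intro always_eventually allI)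
    fix k :: nat
    have "3 * (k + 8) \<le> card (seamed_code (d k))" using card_seamed_code(1)[of "k + 8"]
      by (simp add: d_def)
    then have "3 * real (k + 8) \<le> real (card (seamed_code (d k)))" by linarith
    then show "1 / 4 \<le> real (card (seamed_code (d k))) / real_of_int (6 * d k)"
      by (simp add: d_def field_simps)
  qed
  show "\<forall>\<^sub>F k in sequentially. real (card (seamed_code (d k))) / real_of_int (6 * d k)
      \<le> 1 / 4 + 3 / real (k + 8)"
  proof (intro always_eventually allI)
    fix k :: nat
    have "card (seamed_code (d k)) \<le> 3 * (k + 8) + 36" using card_seamed_code(2)[of "k + 8"]
      by (simp add: d_def)
    then have "real (card (seamed_code (d k))) \<le> 3 * real (k + 8) + 36" by linarith
    then have "real (card (seamed_code (d k))) / (12 * real (k + 8)) \<le> (3 * real (k + 8) + 36) /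
        (12 * real (k + 8))"
      by (intro divide_right_mono) simp_all
    also have "\<dots> = 1 / 4 + 3 / real (k + 8)" by (simp add: field_simps)
    finally show "real (card (seamed_code (d k))) / real_of_int (6 * d k) \<le> 1 / 4 + 3 / real (k + 8)"
      by (simp add: d_def)
  qed
  show "(\<lambda>k. 1 / 4 + 3 / real (k + 8)) \<longlonglongrightarrow> 1 / 4"
    using LIMSEQ_ignore_initial_segment[OF tendsto_add[OF tendsto_const[of "1 / 4 :: real"]
        lim_const_over_n[of "3 :: real"]], of 8] by simp
qed simp

theorem theorem5:
  shows "(\<forall>n d :: int. [d = 8] (mod 57) \<and> d \<ge> 8 \<and> n \<ge> 2 * d \<and> [n = 0] (mod 57) \<longrightarrow>
            real (gamma_LD (circulant n {1, d - 1, d})) = 13 * real_of_int n / 57) \<and>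
         (\<exists>(n :: nat \<Rightarrow> int) (d :: nat \<Rightarrow> int) (C :: nat \<Rightarrow> int set).
            (\<forall>k \<ge> 1. d k \<ge> 3 \<and> real_of_int (d k) \<le> real_of_int (n k) / 2 \<and>
               identifying (circulant (n k) {1, d k - 1, d k}) (C k)) \<and>
            (\<lambda>k. real (card (C k)) / real_of_int (n k)) \<longlonglongrightarrow> 1 / 4)"
proof (intro conjI allI impI)
  fix n d :: int
  assume "[d = 8] (mod 57) \<and> d \<ge> 8 \<and> n \<ge> 2 * d \<and> [n = 0] (mod 57)"
  then have "57 * int (gamma_LD (circulant n {1, d - 1, d})) = 13 * n"
    by (intro gamma_LD_circulant) auto
  then have "57 * real (gamma_LD (circulant n {1, d - 1, d})) = 13 * real_of_int n"
    by (metis of_int_mult of_int_numeral of_int_of_nat_eq)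
  then show "real (gamma_LD (circulant n {1, d - 1, d})) = 13 * real_of_int n / 57" by simp
next
  let ?d = "\<lambda>k. 2 * int (k + 8)"
  have ident: "\<forall>k\<ge>1. 3 \<le> ?d k \<and> real_of_int (?d k) \<le> real_of_int (6 * ?d k) / 2 \<and>
      identifying (circulant (6 * ?d k) {1, ?d k - 1, ?d k}) (seamed_code (?d k))"
    by (intro allI impI conjI seamed_code_identifying) simp_all
  show "\<exists>(n :: nat \<Rightarrow> int) (d :: nat \<Rightarrow> int) (C :: nat \<Rightarrow> int set).
            (\<forall>k \<ge> 1. d k \<ge> 3 \<and> real_of_int (d k) \<le> real_of_int (n k) / 2 \<and>
               identifying (circulant (n k) {1, d k - 1, d k}) (C k)) \<and>
            (\<lambda>k. real (card (C k)) / real_of_int (n k)) \<longlonglongrightarrow> 1 / 4"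
    by (rule exI[of _ "\<lambda>k. 6 * ?d k"], rule exI[of _ ?d], rule exI[of _ "\<lambda>k. seamed_code (?d k)"])
      (rule conjI[OF ident identifying_codes_density_quarter])
qed

end
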